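(* Let $X$ be a finite set with $|X|\geq 2$ and let $\mathrm{FIM}_X$ be the free inverse monoid on $X$. Then $\mathrm{ConjGeo}(\mathrm{FIM}_X)$ is not a context-free language (over the alphabet $\tilde X = X\cup X^{-1}$).
   Context: $\tilde X = X\cup X^{-1}$, where $X^{-1}=\{x^{-1}: x\in X\}$ is a disjoint copy of $X$ consisting of formal inverses; $\tilde X^*$ is the free monoid on $\tilde X$, $\ell(w)$ is the length of a word $w\in\tilde X^*$, and $\pi\colon \tilde X^*\to \mathrm{FIM}_X$ is the canonical surjective homomorphism. A word $w\in\tilde X^*$ is a geodesic if $\ell(w)\le \ell(u)$ for every $u\in \tilde X^*$ with $u\pi=w\pi$; $\mathrm{Geo}(\mathrm{FIM}_X)$ is the set of all geodesics. Two elements $a,b$ of an inverse monoid $S$ are conjugate ($i$-conjugate) if there is $g\in S$ with $g^{-1}ag=b$ and $gbg^{-1}=a$. This is an equivalence relation; $[a]$ denotes the conjugacy class of $a$. $\mathrm{ConjGeo}(\mathrm{FIM}_X)=\{w\in \mathrm{Geo}(\mathrm{FIM}_X): \ell(w)\leq \ell(u)\text{ for all } u\in\tilde X^* \text{ such that } [w\pi]=[u\pi]\}$. *)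

theory Defs
  imports "HOL-Algebra.Group"
begin

section \<open>Inverse monoids and conjugacy\<close>

definition is_sinv :: "('a, 'b) monoid_scheme \<Rightarrow> 'a \<Rightarrow> 'a \<Rightarrow> bool" where
  "is_sinv S x y \<longleftrightarrow> x \<otimes>\<^bsub>S\<^esub> y \<otimes>\<^bsub>S\<^esub> x = x \<and> y \<otimes>\<^bsub>S\<^esub> x \<otimes>\<^bsub>S\<^esub> y = y"

locale inverse_monoid = monoid S for S (structure) +
  assumes ex1_sinv: "x \<in> carrier S \<Longrightarrow> \<exists>!y. y \<in> carrier S \<and> is_sinv S x y"

text \<open>This is the inverse in the sense of inverse semigroups; \<^const>\<open>m_inv\<close> only
  inverts units.\<close>

definition sinv :: "('a, 'b) monoid_scheme \<Rightarrow> 'a \<Rightarrow> 'a" where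
  "sinv S x = (THE y. y \<in> carrier S \<and> is_sinv S x y)"

definition conjugate :: "('a, 'b) monoid_scheme \<Rightarrow> 'a \<Rightarrow> 'a \<Rightarrow> bool" where
  "conjugate S a b \<longleftrightarrow>
     (\<exists>g\<in>carrier S. sinv S g \<otimes>\<^bsub>S\<^esub> a \<otimes>\<^bsub>S\<^esub> g = b \<and> g \<otimes>\<^bsub>S\<^esub> b \<otimes>\<^bsub>S\<^esub> sinv S g = a)"

definition conj_class :: "('a, 'b) monoid_scheme \<Rightarrow> 'a \<Rightarrow> 'a set" where
  "conj_class S a = {b \<in> carrier S. conjugate S a b}"


section \<open>The free inverse monoid\<close>

datatype 'a letter = Gen 'a | Inv 'a

definition letters :: "'a set \<Rightarrow> 'a letter set" where
  "letters X = Gen ` X \<union> Inv ` X"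

primrec letter_inv :: "'a letter \<Rightarrow> 'a letter" where
  "letter_inv (Gen x) = Inv x"
| "letter_inv (Inv x) = Gen x"

definition word_inv :: "'a letter list \<Rightarrow> 'a letter list" where
  "word_inv w = rev (map letter_inv w)"

text \<open>The Vagner congruence on the free monoid over \<^term>\<open>letters X\<close>. By Vagner's
  theorem the quotient by it is the free inverse monoid on \<^term>\<open>X\<close>.\<close>

inductive_set vagner :: "'a set \<Rightarrow> ('a letter list \<times> 'a letter list) set" for X where
  regular: "w \<in> lists (letters X) \<Longrightarrow> (w @ word_inv w @ w, w) \<in> vagner X"
| commute: "\<lbrakk>u \<in> lists (letters X); v \<in> lists (letters X)\<rbrakk> \<Longrightarrow>
    (u @ word_inv u @ v @ word_inv v, v @ word_inv v @ u @ word_inv u) \<in> vagner X"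
| refl: "w \<in> lists (letters X) \<Longrightarrow> (w, w) \<in> vagner X"
| sym: "(u, v) \<in> vagner X \<Longrightarrow> (v, u) \<in> vagner X"
| trans: "\<lbrakk>(u, v) \<in> vagner X; (v, w) \<in> vagner X\<rbrakk> \<Longrightarrow> (u, w) \<in> vagner X"
| cong: "\<lbrakk>(u, v) \<in> vagner X; (u', v') \<in> vagner X\<rbrakk> \<Longrightarrow> (u @ u', v @ v') \<in> vagner X"

definition fim_proj :: "'a set \<Rightarrow> 'a letter list \<Rightarrow> 'a letter list set" where
  "fim_proj X w = vagner X `` {w}"

definition FIM :: "'a set \<Rightarrow> 'a letter list set monoid" where
  "FIM X = \<lparr>carrier = lists (letters X) // vagner X,
            mult = (\<lambda>A B. \<Union>a\<in>A. \<Union>b\<in>B. fim_proj X (a @ b)),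
            one = fim_proj X []\<rparr>"

lemma vagner_lists:
  assumes "(u, v) \<in> vagner X"
  shows "u \<in> lists (letters X) \<and> v \<in> lists (letters X)"
proof -
  have inv: "word_inv w \<in> lists (letters X)" if "w \<in> lists (letters X)" for w
  proof -
    have "letter_inv x \<in> letters X" if "x \<in> letters X" for x
      using that by (auto simp: letters_def)
    with that show ?thesis by (auto simp: word_inv_def in_lists_conv_set)
  qed
  from assms show ?thesis
    by induction (use inv in auto)
qed

lemma word_inv_in_lists: "w \<in> lists (letters X) \<Longrightarrow> word_inv w \<in> lists (letters X)"
  using vagner_lists[OF vagner.regular[of w X]] by simp

lemma word_inv_word_inv: "word_inv (word_inv w) = w"
proof -
  have "letter_inv (letter_inv x) = x" for x :: "'a letter"
    by (cases x) auto
  then show ?thesis by (simp add: word_inv_def rev_map comp_def)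
qed

lemma equiv_vagner: "equiv (lists (letters X)) (vagner X)"
proof (rule equivI)
  show "vagner X \<subseteq> lists (letters X) \<times> lists (letters X)"
    by (auto dest: vagner_lists)
  show "refl_on (lists (letters X)) (vagner X)"
    by (rule refl_onI) (rule vagner.refl)
  show "sym (vagner X)"
    by (rule symI) (rule vagner.sym)
  show "trans (vagner X)"
    by (rule transI) (rule vagner.trans)
qed

lemma fim_proj_eq_iff:
  "\<lbrakk>u \<in> lists (letters X); v \<in> lists (letters X)\<rbrakk> \<Longrightarrow>
    fim_proj X u = fim_proj X v \<longleftrightarrow> (u, v) \<in> vagner X"
  unfolding fim_proj_def by (rule eq_equiv_class_iff[OF equiv_vagner])

lemma carrier_FIM: "carrier (FIM X) = fim_proj X ` lists (letters X)"
  by (auto simp: FIM_def quotient_def fim_proj_def)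

lemma one_FIM: "\<one>\<^bsub>FIM X\<^esub> = fim_proj X []"
  by (simp add: FIM_def)

lemma mult_FIM:
  assumes "u \<in> lists (letters X)" "v \<in> lists (letters X)"
  shows "fim_proj X u \<otimes>\<^bsub>FIM X\<^esub> fim_proj X v = fim_proj X (u @ v)"
proof -
  have "fim_proj X (a @ b) = fim_proj X (u @ v)" if "a \<in> fim_proj X u" "b \<in> fim_proj X v" for a b
  proof -
    from that have "(u, a) \<in> vagner X" "(v, b) \<in> vagner X"
      by (simp_all add: fim_proj_def)
    then have "(u @ v, a @ b) \<in> vagner X"
      by (rule vagner.cong)
    then show ?thesis
      unfolding fim_proj_def by (rule equiv_class_eq[OF equiv_vagner, symmetric])
  qed
  moreover have "u \<in> fim_proj X u" "v \<in> fim_proj X v"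
    using assms by (auto simp: fim_proj_def intro: vagner.refl)
  ultimately show ?thesis
    unfolding FIM_def monoid.simps by blast
qed

lemma monoid_FIM: "monoid (FIM X)"
  by (rule monoidI; unfold carrier_FIM one_FIM; (elim imageE)?)
     (simp_all add: mult_FIM)

lemma is_sinv_FIM:
  assumes "w \<in> lists (letters X)"
  shows "is_sinv (FIM X) (fim_proj X w) (fim_proj X (word_inv w))"
proof -
  have w': "word_inv w \<in> lists (letters X)" using assms by (rule word_inv_in_lists)
  have "(w @ word_inv w @ w, w) \<in> vagner X" using assms by (rule vagner.regular)
  moreover have "(word_inv w @ w @ word_inv w, word_inv w) \<in> vagner X"
    using vagner.regular[OF w'] by (simp add: word_inv_word_inv)
  ultimately show ?thesis
    using assms w' by (simp add: is_sinv_def mult_FIM fim_proj_eq_iff)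
qed

theorem inverse_monoid_FIM: "inverse_monoid (FIM X)"
proof -
  interpret monoid "FIM X" by (rule monoid_FIM)
  let ?S = "FIM X"
  have ex: "\<exists>y\<in>carrier ?S. is_sinv ?S x y" if "x \<in> carrier ?S" for x
    using that is_sinv_FIM word_inv_in_lists unfolding carrier_FIM by blast
  define P where "P e \<longleftrightarrow> (\<exists>u\<in>lists (letters X). e = fim_proj X (u @ word_inv u))" for e
  have P_comm: "e \<otimes>\<^bsub>?S\<^esub> f = f \<otimes>\<^bsub>?S\<^esub> e" if "P e" "P f" for e f
  proof -
    from that obtain u v where uv: "u \<in> lists (letters X)" "v \<in> lists (letters X)"
      and ef: "e = fim_proj X (u @ word_inv u)" "f = fim_proj X (v @ word_inv v)"
      unfolding P_def by blast
    have "(u @ word_inv u @ v @ word_inv v, v @ word_inv v @ u @ word_inv u) \<in> vagner X"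
      using uv by (rule vagner.commute)
    with uv show ?thesis
      by (simp add: ef mult_FIM fim_proj_eq_iff word_inv_in_lists)
  qed
  have idem_P: "P e" if e: "e \<in> carrier ?S" and ee: "e \<otimes>\<^bsub>?S\<^esub> e = e" for e
  proof -
    from e obtain w where w: "w \<in> lists (letters X)" "e = fim_proj X w"
      by (auto simp: carrier_FIM)
    define f where "f = fim_proj X (word_inv w)"
    have w': "word_inv w \<in> lists (letters X)" using w by (simp add: word_inv_in_lists)
    have f: "f \<in> carrier ?S" using w' by (auto simp: carrier_FIM f_def)
    have inv: "e \<otimes>\<^bsub>?S\<^esub> f \<otimes>\<^bsub>?S\<^esub> e = e" "f \<otimes>\<^bsub>?S\<^esub> e \<otimes>\<^bsub>?S\<^esub> f = f"
      using is_sinv_FIM[OF w(1)] by (auto simp: is_sinv_def w f_def)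
    have Pef: "P (e \<otimes>\<^bsub>?S\<^esub> f)"
      unfolding P_def using w w' by (intro bexI[of _ w]) (simp_all add: f_def mult_FIM)
    have Pfe: "P (f \<otimes>\<^bsub>?S\<^esub> e)"
      unfolding P_def using w w'
      by (intro bexI[of _ "word_inv w"]) (simp_all add: f_def mult_FIM word_inv_word_inv)
    have "f = f \<otimes>\<^bsub>?S\<^esub> (e \<otimes>\<^bsub>?S\<^esub> e) \<otimes>\<^bsub>?S\<^esub> f" using inv ee by simp
    also have "\<dots> = (f \<otimes>\<^bsub>?S\<^esub> e) \<otimes>\<^bsub>?S\<^esub> (e \<otimes>\<^bsub>?S\<^esub> f)" using e f by (simp add: m_assoc)
    also have "\<dots> = (e \<otimes>\<^bsub>?S\<^esub> f) \<otimes>\<^bsub>?S\<^esub> (f \<otimes>\<^bsub>?S\<^esub> e)" using Pef Pfe by (rule P_comm[rotated])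
    finally have ff: "f = e \<otimes>\<^bsub>?S\<^esub> f \<otimes>\<^bsub>?S\<^esub> f \<otimes>\<^bsub>?S\<^esub> e" using e f by (simp add: m_assoc)
    have "e \<otimes>\<^bsub>?S\<^esub> f = e \<otimes>\<^bsub>?S\<^esub> (e \<otimes>\<^bsub>?S\<^esub> f \<otimes>\<^bsub>?S\<^esub> f \<otimes>\<^bsub>?S\<^esub> e)" by (rule arg_cong[OF ff])
    also have "\<dots> = (e \<otimes>\<^bsub>?S\<^esub> e) \<otimes>\<^bsub>?S\<^esub> f \<otimes>\<^bsub>?S\<^esub> f \<otimes>\<^bsub>?S\<^esub> e" using e f by (simp add: m_assoc)
    finally have ef: "e \<otimes>\<^bsub>?S\<^esub> f = f" by (simp only: ee ff[symmetric])
    from ef Pef have Pf: "P f" by simp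
    have "f \<otimes>\<^bsub>?S\<^esub> e = (e \<otimes>\<^bsub>?S\<^esub> f \<otimes>\<^bsub>?S\<^esub> f \<otimes>\<^bsub>?S\<^esub> e) \<otimes>\<^bsub>?S\<^esub> e" by (rule arg_cong[OF ff])
    also have "\<dots> = e \<otimes>\<^bsub>?S\<^esub> f \<otimes>\<^bsub>?S\<^esub> f \<otimes>\<^bsub>?S\<^esub> (e \<otimes>\<^bsub>?S\<^esub> e)" using e f by (simp add: m_assoc)
    finally have "f \<otimes>\<^bsub>?S\<^esub> e = f" by (simp only: ee ff[symmetric])
    with ef inv have "e = f" by simp
    with Pf show ?thesis by simp
  qed
  have uniq: "y = z" if x: "x \<in> carrier ?S" and y: "y \<in> carrier ?S" and z: "z \<in> carrier ?S"
    and iy: "is_sinv ?S x y" and iz: "is_sinv ?S x z" for x y z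
  proof -
    have xy: "x \<otimes>\<^bsub>?S\<^esub> y \<otimes>\<^bsub>?S\<^esub> x = x" "y \<otimes>\<^bsub>?S\<^esub> x \<otimes>\<^bsub>?S\<^esub> y = y"
      and xz: "x \<otimes>\<^bsub>?S\<^esub> z \<otimes>\<^bsub>?S\<^esub> x = x" "z \<otimes>\<^bsub>?S\<^esub> x \<otimes>\<^bsub>?S\<^esub> z = z"
      using iy iz by (auto simp: is_sinv_def)
    have Ps: "P (x \<otimes>\<^bsub>?S\<^esub> y)" "P (y \<otimes>\<^bsub>?S\<^esub> x)" "P (x \<otimes>\<^bsub>?S\<^esub> z)" "P (z \<otimes>\<^bsub>?S\<^esub> x)"
      by (rule idem_P; use x y z xy xz in \<open>simp add: m_assoc[symmetric]\<close>)+
    have c1: "(y \<otimes>\<^bsub>?S\<^esub> x) \<otimes>\<^bsub>?S\<^esub> (z \<otimes>\<^bsub>?S\<^esub> x) = (z \<otimes>\<^bsub>?S\<^esub> x) \<otimes>\<^bsub>?S\<^esub> (y \<otimes>\<^bsub>?S\<^esub> x)"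
      using Ps by (intro P_comm)
    have c2: "(x \<otimes>\<^bsub>?S\<^esub> y) \<otimes>\<^bsub>?S\<^esub> (x \<otimes>\<^bsub>?S\<^esub> z) = (x \<otimes>\<^bsub>?S\<^esub> z) \<otimes>\<^bsub>?S\<^esub> (x \<otimes>\<^bsub>?S\<^esub> y)"
      using Ps by (intro P_comm)
    have "y \<otimes>\<^bsub>?S\<^esub> x = y \<otimes>\<^bsub>?S\<^esub> (x \<otimes>\<^bsub>?S\<^esub> z \<otimes>\<^bsub>?S\<^esub> x)" using xz by simp
    also have "\<dots> = (y \<otimes>\<^bsub>?S\<^esub> x) \<otimes>\<^bsub>?S\<^esub> (z \<otimes>\<^bsub>?S\<^esub> x)" using x y z by (simp add: m_assoc)
    also have "\<dots> = z \<otimes>\<^bsub>?S\<^esub> (x \<otimes>\<^bsub>?S\<^esub> y \<otimes>\<^bsub>?S\<^esub> x)" unfolding c1 using x y z by (simp add: m_assoc)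
    finally have yx: "y \<otimes>\<^bsub>?S\<^esub> x = z \<otimes>\<^bsub>?S\<^esub> x" using xy by simp
    have "x \<otimes>\<^bsub>?S\<^esub> y = (x \<otimes>\<^bsub>?S\<^esub> z \<otimes>\<^bsub>?S\<^esub> x) \<otimes>\<^bsub>?S\<^esub> y" using xz by simp
    also have "\<dots> = (x \<otimes>\<^bsub>?S\<^esub> z) \<otimes>\<^bsub>?S\<^esub> (x \<otimes>\<^bsub>?S\<^esub> y)" using x y z by (simp add: m_assoc)
    also have "\<dots> = (x \<otimes>\<^bsub>?S\<^esub> y \<otimes>\<^bsub>?S\<^esub> x) \<otimes>\<^bsub>?S\<^esub> z" unfolding c2[symmetric] using x y z by (simp add: m_assoc)
    finally have xyz: "x \<otimes>\<^bsub>?S\<^esub> y = x \<otimes>\<^bsub>?S\<^esub> z" using xy by simp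
    have "y = z \<otimes>\<^bsub>?S\<^esub> x \<otimes>\<^bsub>?S\<^esub> y" using yx xy by simp
    also have "\<dots> = z \<otimes>\<^bsub>?S\<^esub> (x \<otimes>\<^bsub>?S\<^esub> z)" using x y z xyz by (simp add: m_assoc)
    also have "\<dots> = z" using x z xz by (simp add: m_assoc)
    finally show ?thesis .
  qed
  show ?thesis
  proof
    fix x assume x: "x \<in> carrier ?S"
    with ex obtain y where "y \<in> carrier ?S" "is_sinv ?S x y" by blast
    with x uniq show "\<exists>!y. y \<in> carrier ?S \<and> is_sinv ?S x y"
      by (intro ex1I[of _ y]) auto
  qed
qed

lemma sinv_FIM:
  assumes "w \<in> lists (letters X)"
  shows "sinv (FIM X) (fim_proj X w) = fim_proj X (word_inv w)"
proof -
  have "fim_proj X w \<in> carrier (FIM X)" "fim_proj X (word_inv w) \<in> carrier (FIM X)"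
    using assms by (auto simp: carrier_FIM word_inv_in_lists)
  then show ?thesis
    using inverse_monoid.ex1_sinv[OF inverse_monoid_FIM] is_sinv_FIM[OF assms]
    unfolding sinv_def by (intro the1_equality) auto
qed


section \<open>Geodesics and conjugacy geodesics\<close>

definition Geo :: "'a set \<Rightarrow> 'a letter list set" where
  "Geo X = {w \<in> lists (letters X).
     \<forall>u\<in>lists (letters X). fim_proj X u = fim_proj X w \<longrightarrow> length w \<le> length u}"

definition ConjGeo :: "'a set \<Rightarrow> 'a letter list set" where
  "ConjGeo X = {w \<in> Geo X.
     \<forall>u\<in>lists (letters X).
       conj_class (FIM X) (fim_proj X w) = conj_class (FIM X) (fim_proj X u) \<longrightarrow> length w \<le> length u}"


section \<open>Context-free languages\<close>

record ('n, 't) cfg =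
  nonterminals :: "'n set"
  terminals :: "'t set"
  productions :: "('n \<times> ('n + 't) list) set"
  start :: 'n

definition wf_cfg :: "('n, 't) cfg \<Rightarrow> bool" where
  "wf_cfg G \<longleftrightarrow>
     finite (nonterminals G) \<and> finite (terminals G) \<and> finite (productions G) \<and>
     productions G \<subseteq> nonterminals G \<times> lists (nonterminals G <+> terminals G) \<and>
     start G \<in> nonterminals G"

inductive derives1 :: "('n, 't) cfg \<Rightarrow> ('n + 't) list \<Rightarrow> ('n + 't) list \<Rightarrow> bool" for G where
  "(A, \<gamma>) \<in> productions G \<Longrightarrow> derives1 G (\<alpha> @ [Inl A] @ \<beta>) (\<alpha> @ \<gamma> @ \<beta>)"

definition cfg_lang :: "('n, 't) cfg \<Rightarrow> 't list set" where
  "cfg_lang G = {w \<in> lists (terminals G). (derives1 G)\<^sup>*\<^sup>* [Inl (start G)] (map Inr w)}"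

text \<open>Taking the nonterminals from \<^typ>\<open>nat\<close> is no restriction: there are only finitely many
  of them, so those of any grammar can be renamed to natural numbers.\<close>

definition context_free :: "'t set \<Rightarrow> 't list set \<Rightarrow> bool" where
  "context_free \<Sigma> L \<longleftrightarrow>
     (\<exists>G :: (nat, 't) cfg. wf_cfg G \<and> terminals G = \<Sigma> \<and> cfg_lang G = L)"

end

theory Submission
  imports Defs
begin

text \<open>In terms of Munn trees, the conjugates of an element \<open>(T, u)\<close> of the free inverse monoid are
  the \<open>(h\<^sup>-\<^sup>1T, h\<^sup>-\<^sup>1uh)\<close> with \<open>h\<close> and \<open>uh\<close> in \<open>T\<close>, and geodesics have length
  \<open>2|E(T)| - |u|\<close>. So a geodesic is a conjugacy geodesic iff no \<open>h\<close> in \<open>T\<close> with \<open>uh\<close> in \<open>T\<close> has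
  \<open>|h\<^sup>-\<^sup>1uh| > |u|\<close>. Let \<open>a\<close>, \<open>b\<close> be two generators and let \<open>T\<close> be a comb: an axis in direction \<open>b\<close> with
  some teeth \<open>a\<close>. For \<open>u = b\<^sup>m\<close> such an \<open>h\<close> exists iff two teeth are at distance \<open>m\<close>.

  The word \<open>Z b\<^sup>c Z b\<^sup>d Z b\<^sup>e Z b\<^sup>-\<^sup>r\<close> with \<open>Z = a a\<^sup>-\<^sup>1\<close> has \<open>m = c + d + e - r\<close> and teeth at \<open>0\<close>, \<open>c\<close>,
  \<open>c + d\<close> and \<open>c + d + e\<close>. It is not a conjugacy geodesic if \<open>r\<close> is \<open>c + d\<close>, \<open>c + e\<close> or \<open>d + e\<close>, but it
  is one for \<open>(c, d, e, r) = (3K, 3K, K, 5K)\<close>. If \<open>K\<close> is the factorial of the pumping constant, every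
  way of pumping this word within its blocks reaches one of the three equations: pumping \<open>r\<close>
  raises it to \<open>c + d = 6K\<close>, and pumping the other blocks raises \<open>c + e\<close> or \<open>d + e\<close> from \<open>4K\<close> to \<open>5K\<close>.\<close>

section \<open>Context-free grammars: derivations, parse forests and pumping with colours\<close>

section \<open>A pumping lemma\<close>

abbreviation derives :: "('n, 't) cfg \<Rightarrow> ('n + 't) list \<Rightarrow> ('n + 't) list \<Rightarrow> bool" where
  "derives G \<equiv> (derives1 G)\<^sup>*\<^sup>*"

lemma derives1_context:
  assumes "derives1 G \<alpha> \<beta>"
  shows "derives1 G (p @ \<alpha> @ s) (p @ \<beta> @ s)"
  using assms
proof cases
  case (1 A \<gamma> \<alpha>' \<beta>')
  then show ?thesis
    using derives1.intros[of A \<gamma> G "p @ \<alpha>'" "\<beta>' @ s"] by simp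
qed

lemma derives_context:
  assumes "derives G \<alpha> \<beta>"
  shows "derives G (p @ \<alpha> @ s) (p @ \<beta> @ s)"
  using assms
  by induction (auto intro: derives1_context rtranclp.rtrancl_into_rtrancl)

lemma derives_production: "(A, \<gamma>) \<in> productions G \<Longrightarrow> derives G [Inl A] \<gamma>"
  using derives1.intros[of A \<gamma> G "[]" "[]"] by auto

lemma derives_nest:
  assumes "derives G \<alpha> (map Inr u @ [Inl A] @ map Inr z)"
    and "derives G [Inl A] (map Inr v @ \<beta> @ map Inr y)"
  shows "derives G \<alpha> (map Inr (u @ v) @ \<beta> @ map Inr (y @ z))"
  using rtranclp_trans[OF assms(1) derives_context[OF assms(2), of "map Inr u" "map Inr z"]]
  by simp

text \<open>Parse forests of a sentential form. The number counts the nonterminal nodes; it is the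
  induction measure where a chain of nodes has the same yield.\<close>

inductive parse :: "('n, 't) cfg \<Rightarrow> nat \<Rightarrow> ('n + 't) list \<Rightarrow> 't list \<Rightarrow> bool" for G where
  Nil: "parse G 0 [] []"
| Term: "parse G n s w \<Longrightarrow> parse G n (Inr t # s) (t # w)"
| NT: "\<lbrakk>(A, \<gamma>) \<in> productions G; parse G n \<gamma> v; parse G m s w\<rbrakk> \<Longrightarrow>
    parse G (Suc (n + m)) (Inl A # s) (v @ w)"

inductive_cases parse_NilE: "parse G n [] w"
inductive_cases parse_TermE: "parse G n (Inr t # s) w"
inductive_cases parse_NTE: "parse G n (Inl A # s) w"

lemma parse_single:
  assumes "parse G n [Inl A] w"
  obtains \<gamma> k where "(A, \<gamma>) \<in> productions G" "parse G k \<gamma> w" "k < n"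
  using assms by (auto elim!: parse_NTE parse_NilE)

lemma parse_append:
  "parse G n s v \<Longrightarrow> parse G m t w \<Longrightarrow> parse G (n + m) (s @ t) (v @ w)"
proof (induction rule: parse.induct)
  case (NT A \<gamma> n v k s w')
  then show ?case using parse.NT[of A \<gamma> G n v "k + m" "s @ t" "w' @ w"] by (simp add: add.assoc)
qed (auto intro: parse.intros)

lemma parse_appendE:
  assumes "parse G n (s @ t) w"
  obtains k m u v where "w = u @ v" "parse G k s u" "parse G m t v"
proof -
  have "\<exists>k m u v. w = u @ v \<and> parse G k s u \<and> parse G m t v"
    using assms
  proof (induction s arbitrary: n w)
    case Nil
    then show ?case by (metis append_Nil parse.Nil)
  next
    case (Cons a s)
    show ?case
    proof (cases a)
      case (Inl A)
      with Cons.prems obtain \<gamma> i v j w' where *: "(A, \<gamma>) \<in> productions G" "parse G i \<gamma> v"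
        "parse G j (s @ t) w'" "w = v @ w'"
        by (auto elim: parse_NTE)
      from Cons.IH[OF *(3)] obtain k m u' v' where "w' = u' @ v'" "parse G k s u'" "parse G m t v'"
        by blast
      then show ?thesis
        using parse.NT[OF *(1,2)] *(4) Inl by (metis append_assoc)
    next
      case (Inr b)
      with Cons.prems obtain w' where *: "parse G n (s @ t) w'" "w = b # w'"
        by (auto elim: parse_TermE)
      from Cons.IH[OF *(1)] obtain k m u' v' where "w' = u' @ v'" "parse G k s u'" "parse G m t v'"
        by blast
      then show ?thesis
        using parse.Term *(2) Inr by (metis append_Cons)
    qed
  qed
  then show ?thesis using that by blast
qed

lemma parse_derives: "parse G n s w \<Longrightarrow> derives G s (map Inr w)"
proof (induction rule: parse.induct)
  case (Term n s w t)
  then show ?case using derives_context[of G s "map Inr w" "[Inr t]" "[]"] by simp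
next
  case (NT A \<gamma> n v m s w)
  have "derives G (Inl A # s) (map Inr v @ s)"
    using rtranclp_trans[OF derives_production[OF NT(1)] NT(4)]
      derives_context[of G "[Inl A]" "map Inr v" "[]" s] by simp
  also have "derives G \<dots> (map Inr v @ map Inr w)"
    using derives_context[OF NT(5), of "map Inr v" "[]"] by simp
  finally show ?case by simp
qed simp

lemma parse_word: "parse G 0 (map Inr w) w"
  by (induction w) (auto intro: parse.intros)

lemma derives_parse:
  assumes "derives G s (map Inr w)"
  shows "\<exists>n. parse G n s w"
  using assms
proof (induction rule: converse_rtranclp_induct)
  case base
  show ?case using parse_word by blast
next
  case (step s s')
  from step(3) obtain n where n: "parse G n s' w" by blast
  from step(1) show ?case
  proof cases
    case (1 A \<gamma> \<alpha> \<beta>)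
    from n[unfolded 1] obtain k m u v where u: "w = u @ v" "parse G k \<alpha> u" "parse G m (\<gamma> @ \<beta>) v"
      by (rule parse_appendE)
    from u(3) obtain k' m' u' v' where v: "v = u' @ v'" "parse G k' \<gamma> u'" "parse G m' \<beta> v'"
      by (rule parse_appendE)
    show ?thesis
      using parse_append[OF u(2) parse.NT[OF 1(3) v(2,3)]] 1(1) u(1) v(1) by auto
  qed
qed

text \<open>Pigeonhole: if every symbol of \<open>s\<close> yielded at most \<open>k\<close>
  letters, \<open>w\<close> would have at most \<open>k * length s\<close>. A symbol with a longer
  yield is a nonterminal, because \<open>1 \<le> k\<close> covers the terminals.\<close>

lemma parse_large_part:
  assumes "parse G n s w" "k * length s < length w" "1 \<le> k"
  shows "\<exists>B u x z m. w = u @ x @ z \<and> m \<le> n \<and> parse G m [Inl B] x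
    \<and> derives G s (map Inr u @ [Inl B] @ map Inr z) \<and> k < length x"
  using assms
proof (induction rule: parse.induct)
  case (Term n s w t)
  then obtain B u x z m where *: "w = u @ x @ z" "m \<le> n" "parse G m [Inl B] x"
    "derives G s (map Inr u @ [Inl B] @ map Inr z)" "k < length x"
    by fastforce
  show ?case
    using * derives_context[OF *(4), of "[Inr t]" "[]"]
    by (intro exI[of _ B] exI[of _ "t # u"] exI[of _ x] exI[of _ z] exI[of _ m]) simp
next
  case (NT A \<gamma> n v m s w)
  have A: "parse G (Suc n) [Inl A] v"
    using parse.NT[OF NT(1,2) parse.Nil] by simp
  show ?case
  proof (cases "k < length v")
    case True
    then show ?thesis
      using A derives_context[OF parse_derives[OF NT(3)], of "[Inl A]" "[]"]
      by (intro exI[of _ A] exI[of _ "[]"] exI[of _ v] exI[of _ w] exI[of _ "Suc n"]) simp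
  next
    case False
    with NT obtain B u x z m' where *: "w = u @ x @ z" "m' \<le> m" "parse G m' [Inl B] x"
      "derives G s (map Inr u @ [Inl B] @ map Inr z)" "k < length x"
      by fastforce
    have "derives G (Inl A # s) (map Inr v @ s)"
      using derives_context[OF parse_derives[OF A], of "[]" s] by simp
    also have "derives G \<dots> (map Inr v @ map Inr u @ [Inl B] @ map Inr z)"
      using derives_context[OF *(4), of "map Inr v" "[]"] by simp
    finally show ?thesis
      using *
      by (intro exI[of _ B] exI[of _ "v @ u"] exI[of _ x] exI[of _ z] exI[of _ m']) simp
  qed
qed simp

text \<open>A production has at most \<open>M\<close> symbols, so one of them keeps a yield longer
  than \<open>k\<close>. If that symbol yields all of \<open>w\<close>, the descent continues from
  it with a smaller parse, until the yield gets strictly shorter.\<close>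

lemma parse_shrink:
  assumes "\<forall>p\<in>productions G. length (snd p) \<le> M"
    and "parse G n [Inl A] w" "k * M < length w" "1 \<le> k"
  shows "\<exists>B u x z m. w = u @ x @ z \<and> parse G m [Inl B] x
    \<and> derives G [Inl A] (map Inr u @ [Inl B] @ map Inr z) \<and> k < length x \<and> length x < length w"
  using assms(2-3)
proof (induction n arbitrary: A rule: less_induct)
  case (less n)
  from less.prems(1) obtain \<gamma> i where \<gamma>: "(A, \<gamma>) \<in> productions G" "parse G i \<gamma> w" "i < n"
    by (rule parse_single)
  have "k * length \<gamma> \<le> k * M" using assms(1) \<gamma>(1) by force
  with less.prems(2) have "k * length \<gamma> < length w" by linarith
  from parse_large_part[OF \<gamma>(2) this assms(4)]
  obtain B u x z m where *: "w = u @ x @ z" "m \<le> i" "parse G m [Inl B] x"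
    "derives G \<gamma> (map Inr u @ [Inl B] @ map Inr z)" "k < length x"
    by blast
  from rtranclp_trans[OF derives_production[OF \<gamma>(1)] *(4)]
  have AB: "derives G [Inl A] (map Inr u @ [Inl B] @ map Inr z)" .
  show ?case
  proof (cases "length x < length w")
    case True
    with * AB show ?thesis by blast
  next
    case False
    with *(1) have [simp]: "u = []" "z = []" "x = w" by auto
    have "m < n" using * \<gamma> by simp
    from less.IH[OF this *(3)[simplified] less.prems(2)]
    obtain B' u' x' z' m' where **: "w = u' @ x' @ z'" "parse G m' [Inl B'] x'"
      "derives G [Inl B] (map Inr u' @ [Inl B'] @ map Inr z')" "k < length x'" "length x' < length w"
      by blast
    from rtranclp_trans[OF AB, of "map Inr u' @ [Inl B'] @ map Inr z'"] **(3)
    have "derives G [Inl A] (map Inr u' @ [Inl B'] @ map Inr z')" by simp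
    with ** show ?thesis by blast
  qed
qed

text \<open>A node is labelled by its nonterminal and the colours at both ends of its yield;
  \<open>i\<close> is the offset of \<open>w\<close> in the full word. \<open>F\<close> holds the
  labels of ancestors, and \<open>d\<close> counts the labels still unseen. Each descent costs a
  factor \<open>M\<close> in length, so a word longer than \<open>M ^ d\<close> allows descending
  until a label recurs: either within the tree of \<open>w\<close>, or as a label from
  \<open>F\<close>.\<close>

lemma parse_repetition:
  fixes col :: "nat \<Rightarrow> nat"
  assumes M: "\<forall>p\<in>productions G. length (snd p) \<le> M" "1 \<le> M"
    and fin: "finite \<Lambda>"
    and \<Lambda>: "\<forall>p\<in>productions G. \<forall>i j. (fst p, col i, col j) \<in> \<Lambda>"
    and "parse G n [Inl A] w" "card (\<Lambda> - F) = d" "M ^ d < length w"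
  shows "(\<exists>B u v x y z. w = u @ v @ x @ y @ z \<and> derives G [Inl A] (map Inr u @ [Inl B] @ map Inr z)
      \<and> derives G [Inl B] (map Inr v @ [Inl B] @ map Inr y) \<and> derives G [Inl B] (map Inr x)
      \<and> v @ y \<noteq> [] \<and> col (i + length u) = col (i + length (u @ v))
      \<and> col (i + length (u @ v @ x)) = col (i + length (u @ v @ x @ y)))
    \<or> (\<exists>B u x z. w = u @ x @ z \<and> derives G [Inl A] (map Inr u @ [Inl B] @ map Inr z)
      \<and> derives G [Inl B] (map Inr x) \<and> (B, col (i + length u), col (i + length (u @ x))) \<in> F)"
  using assms(5-)
proof (induction d arbitrary: n A w i F)
  case 0
  from 0(1) obtain \<gamma> k where "(A, \<gamma>) \<in> productions G" by (rule parse_single)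
  then have "(A, col i, col (i + length w)) \<in> F"
    using 0(2) fin \<Lambda> by fastforce
  then show ?case
    using parse_derives[OF 0(1)]
    by (intro disjI2 exI[of _ A] exI[of _ "[]"] exI[of _ w] exI[of _ "[]"]) simp
next
  case (Suc d)
  define lab where "lab = (A, col i, col (i + length w))"
  from Suc.prems(1) obtain \<gamma> k where "(A, \<gamma>) \<in> productions G" by (rule parse_single)
  then have lab: "lab \<in> \<Lambda>" using \<Lambda> by (force simp: lab_def)
  show ?case
  proof (cases "lab \<in> F")
    case True
    then show ?thesis
      using parse_derives[OF Suc.prems(1)]
      by (intro disjI2 exI[of _ A] exI[of _ "[]"] exI[of _ w] exI[of _ "[]"]) (simp add: lab_def)
  next
    case False
    have "M ^ d * M < length w" "1 \<le> M ^ d" using Suc.prems(3) M(2) by (auto simp: mult.commute)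
    from parse_shrink[OF M(1) Suc.prems(1) this]
    obtain B u x z m where B: "w = u @ x @ z" "parse G m [Inl B] x"
      "derives G [Inl A] (map Inr u @ [Inl B] @ map Inr z)" "M ^ d < length x" "length x < length w"
      by blast
    have "\<Lambda> - insert lab F = (\<Lambda> - F) - {lab}" by blast
    then have "card (\<Lambda> - insert lab F) = d"
      using Suc.prems(2) lab False fin by simp
    from Suc.IH[OF B(2) this B(4), of "i + length u"] show ?thesis
    proof (elim disjE exE conjE)
      fix C u' v x' y z'
      assume *: "x = u' @ v @ x' @ y @ z'" "derives G [Inl B] (map Inr u' @ [Inl C] @ map Inr z')"
        "derives G [Inl C] (map Inr v @ [Inl C] @ map Inr y)" "derives G [Inl C] (map Inr x')"
        "v @ y \<noteq> []" "col (i + length u + length u') = col (i + length u + length (u' @ v))"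
        "col (i + length u + length (u' @ v @ x')) = col (i + length u + length (u' @ v @ x' @ y))"
      show ?thesis
        using * B(1) derives_nest[OF B(3) *(2)]
        by (intro disjI1 exI[of _ C] exI[of _ "u @ u'"] exI[of _ v] exI[of _ x'] exI[of _ y]
            exI[of _ "z' @ z"]) (simp add: add.assoc)
    next
      fix C u' x' z'
      assume *: "x = u' @ x' @ z'" "derives G [Inl B] (map Inr u' @ [Inl C] @ map Inr z')"
        "derives G [Inl C] (map Inr x')"
        "(C, col (i + length u + length u'), col (i + length u + length (u' @ x'))) \<in> insert lab F"
      have AC: "derives G [Inl A] (map Inr (u @ u') @ [Inl C] @ map Inr (z' @ z))"
        by (rule derives_nest[OF B(3) *(2)])
      show ?thesis
      proof (cases "(C, col (i + length u + length u'), col (i + length u + length (u' @ x'))) \<in> F")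
        case True
        then show ?thesis
          using * B(1) AC
          by (intro disjI2 exI[of _ C] exI[of _ "u @ u'"] exI[of _ x'] exI[of _ "z' @ z"])
            (simp add: add.assoc)
      next
        case False
        \<comment> \<open>The recurring label is that of the root itself, so the words on both sides
          of \<open>x'\<close> become the pumped pair.\<close>
        with *(4) have eq: "C = A" "col (i + length u + length u') = col i"
          "col (i + length u + length (u' @ x')) = col (i + length w)"
          by (auto simp: lab_def)
        have "length x' < length w" using *(1) B(5) by auto
        then have "u @ u' @ z' @ z \<noteq> []" using *(1) B(1) by auto
        then show ?thesis
          using *(1,3) B(1) AC eq
          by (intro disjI1 exI[of _ A] exI[of _ "[]"] exI[of _ "u @ u'"] exI[of _ x']
              exI[of _ "z' @ z"]) (simp add: add.assoc)
      qed
    qed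
  qed
qed

lemma derives_pump:
  assumes "derives G [Inl B] (map Inr v @ [Inl B] @ map Inr y)"
  shows "derives G [Inl B] (map Inr (concat (replicate k v)) @ [Inl B] @ map Inr (concat (replicate k y)))"
proof (induction k)
  case (Suc k)
  \<comment> \<open>Nesting puts the new copy of \<open>y\<close> to the right of the power, whereas
    \<open>replicate_Suc\<close> has it on the left.\<close>
  have "concat (replicate k y) @ y = y @ concat (replicate k y)"
    by (induction k) auto
  then show ?case using derives_nest[OF assms Suc]
    by (metis append_assoc concat.simps(2) map_append replicate_Suc)
qed simp

text \<open>Colouring the positions of the word by the states of an automaton makes the pumped words
  stay in the regular language of that automaton.\<close>

theorem coloured_pumping:
  assumes "wf_cfg G"
  obtains N where "\<And>w (col :: nat \<Rightarrow> nat). \<lbrakk>w \<in> cfg_lang G; N \<le> length w; \<And>i. col i < c\<rbrakk> \<Longrightarrow>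
    \<exists>u v x y z. w = u @ v @ x @ y @ z \<and> length (v @ x @ y) \<le> N \<and> v @ y \<noteq> []
      \<and> col (length u) = col (length (u @ v))
      \<and> col (length (u @ v @ x)) = col (length (u @ v @ x @ y))
      \<and> (\<forall>k. u @ concat (replicate k v) @ x @ concat (replicate k y) @ z \<in> cfg_lang G)"
proof -
  have fin: "finite (productions G)" using assms by (simp add: wf_cfg_def)
  \<comment> \<open>The inserted 0 covers a grammar without productions, and \<open>Suc\<close>
    gives \<open>1 \<le> M\<close>.\<close>
  define M where "M = Suc (Max (insert 0 ((length \<circ> snd) ` productions G)))"
  have M: "\<forall>p\<in>productions G. length (snd p) \<le> M"
  proof
    fix p assume "p \<in> productions G"
    then have "length (snd p) \<le> Max (insert 0 ((length \<circ> snd) ` productions G))"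
      using fin by (intro Max_ge) auto
    then show "length (snd p) \<le> M" by (simp add: M_def)
  qed
  have M1: "1 \<le> M" by (simp add: M_def)
  define \<Lambda> where "\<Lambda> = fst ` productions G \<times> {..<c} \<times> {..<c}"
  have fin\<Lambda>: "finite \<Lambda>" using fin by (simp add: \<Lambda>_def)
  define T where "T = M ^ card \<Lambda>"
  have T1: "1 \<le> T" using M1 by (simp add: T_def)
  show thesis
  proof (rule that)
    fix w :: "'b list" and col :: "nat \<Rightarrow> nat"
    assume w: "w \<in> cfg_lang G" and len: "Suc (T * M) \<le> length w" and col: "\<And>i. col i < c"
    \<comment> \<open>\<open>P\<close> selects the nodes whose yield is longer than
      \<open>T\<close>, long enough for a label to recur. For a shortest such yield,
      \<open>parse_shrink\<close> gives the upper bound \<open>T * M\<close>, and with it the bound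
      on \<open>v @ x @ y\<close>.\<close>
    define P where "P x \<longleftrightarrow> T < length x \<and> (\<exists>A p s n. w = p @ x @ s \<and> parse G n [Inl A] x
      \<and> derives G [Inl (start G)] (map Inr p @ [Inl A] @ map Inr s))" for x
    obtain n where "parse G n [Inl (start G)] w"
      using w derives_parse unfolding cfg_lang_def by blast
    moreover have "T < length w"
    proof -
      have "T \<le> T * M" using M1 by simp
      with len show ?thesis by linarith
    qed
    ultimately have "P w"
      unfolding P_def by (auto intro!: exI[of _ "[]"])
    then obtain x where "P x" and min: "\<And>x'. P x' \<Longrightarrow> length x \<le> length x'"
      using ex_has_least_nat[of P w length] by blast
    then obtain A p s n where x: "T < length x" "w = p @ x @ s" "parse G n [Inl A] x"
      "derives G [Inl (start G)] (map Inr p @ [Inl A] @ map Inr s)"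
      by (auto simp: P_def)
    have short: "length x \<le> T * M"
    proof (rule ccontr)
      assume "\<not> ?thesis"
      then have "T * M < length x" by simp
      from parse_shrink[OF M x(3) this T1]
      obtain B u x' z m where *: "x = u @ x' @ z" "parse G m [Inl B] x'"
        "derives G [Inl A] (map Inr u @ [Inl B] @ map Inr z)" "T < length x'" "length x' < length x"
        by blast
      have "P x'"
        unfolding P_def using * x derives_nest[OF x(4) *(3)]
        by (intro conjI exI[of _ B] exI[of _ "p @ u"] exI[of _ "z @ s"] exI[of _ m]) auto
      with min *(5) show False by fastforce
    qed
    have "\<forall>p\<in>productions G. \<forall>i j. (fst p, col i, col j) \<in> \<Lambda>"
      using col by (auto simp: \<Lambda>_def)
    \<comment> \<open>With \<open>F\<close> empty the second alternative is impossible, so the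
      repetition lies within \<open>x\<close>.\<close>
    from parse_repetition[OF M M1 fin\<Lambda> this x(3), of "{}" "card \<Lambda>" "length p"]
    obtain B u v y' y z where *: "x = u @ v @ y' @ y @ z"
      "derives G [Inl A] (map Inr u @ [Inl B] @ map Inr z)"
      "derives G [Inl B] (map Inr v @ [Inl B] @ map Inr y)" "derives G [Inl B] (map Inr y')"
      "v @ y \<noteq> []" "col (length p + length u) = col (length p + length (u @ v))"
      "col (length p + length (u @ v @ y')) = col (length p + length (u @ v @ y' @ y))"
      using x(1) by (auto simp: T_def)
    have "(p @ u) @ concat (replicate k v) @ y' @ concat (replicate k y) @ z @ s \<in> cfg_lang G" for k
    proof -
      have "derives G [Inl (start G)] (map Inr (p @ u) @ [Inl B] @ map Inr (z @ s))"
        by (rule derives_nest[OF x(4) *(2)])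
      from derives_nest[OF this derives_pump[OF *(3), of k]]
      have "derives G [Inl (start G)] (map Inr ((p @ u) @ concat (replicate k v)) @ [Inl B] @
        map Inr (concat (replicate k y) @ z @ s))" .
      then have "derives G [Inl (start G)]
        (map Inr (((p @ u) @ concat (replicate k v)) @ []) @ map Inr y'
          @ map Inr ([] @ concat (replicate k y) @ z @ s))"
        by (rule derives_nest) (use *(4) in simp)
      then have "derives G [Inl (start G)]
        (map Inr ((p @ u) @ concat (replicate k v) @ y' @ concat (replicate k y) @ z @ s))"
        by simp
      moreover have "(p @ u) @ concat (replicate k v) @ y' @ concat (replicate k y) @ z @ s
          \<in> lists (terminals G)"
        using w x(2) *(1) by (auto simp: cfg_lang_def)
      ultimately show ?thesis by (simp add: cfg_lang_def)
    qed
    then show "\<exists>u v x y z. w = u @ v @ x @ y @ z \<and> length (v @ x @ y) \<le> Suc (T * M) \<and> v @ y \<noteq> []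
      \<and> col (length u) = col (length (u @ v))
      \<and> col (length (u @ v @ x)) = col (length (u @ v @ x @ y))
      \<and> (\<forall>k. u @ concat (replicate k v) @ x @ concat (replicate k y) @ z \<in> cfg_lang G)"
      using * x(2) short
      by (intro exI[of _ "p @ u"] exI[of _ v] exI[of _ y'] exI[of _ y] exI[of _ "z @ s"])
        (simp add: add.assoc)
  qed
qed

section \<open>Idempotent words and conjugacy of words in the free inverse monoid\<close>

section \<open>Words modulo the Vagner congruence\<close>

lemma word_inv_simps [simp]:
  "word_inv [] = []"
  "word_inv (l # w) = word_inv w @ [letter_inv l]"
  "word_inv (u @ v) = word_inv v @ word_inv u"
  "word_inv (replicate n l) = replicate n (letter_inv l)"
  by (simp_all add: word_inv_def)

declare word_inv_word_inv [simp]

declare in_listsD [rule del] in_listsI [rule del]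

locale free_inverse =
  fixes X :: "'a set"
begin

abbreviation words :: "'a letter list set" where "words \<equiv> lists (letters X)"

definition eqv :: "'a letter list \<Rightarrow> 'a letter list \<Rightarrow> bool" (infix "\<approx>" 50) where
  "u \<approx> v \<longleftrightarrow> (u, v) \<in> vagner X"

lemma word_inv_words [simp]: "w \<in> words \<Longrightarrow> word_inv w \<in> words"
  by (rule word_inv_in_lists)

lemma eqv_refl: "w \<in> words \<Longrightarrow> w \<approx> w"
  by (simp add: eqv_def vagner.refl)

lemma eqv_sym: "u \<approx> v \<Longrightarrow> v \<approx> u"
  by (simp add: eqv_def vagner.sym)

lemma eqv_trans [trans]: "u \<approx> v \<Longrightarrow> v \<approx> w \<Longrightarrow> u \<approx> w"
  unfolding eqv_def by (rule vagner.trans)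

lemma eqv_words: "u \<approx> v \<Longrightarrow> u \<in> words" "u \<approx> v \<Longrightarrow> v \<in> words"
  unfolding eqv_def by (auto dest: vagner_lists)

lemma eqv_context:
  assumes "u \<approx> v" "p \<in> words" "s \<in> words"
  shows "p @ u @ s \<approx> p @ v @ s"
  using assms unfolding eqv_def by (intro vagner.cong vagner.refl)

lemma eqv_append: "u \<approx> v \<Longrightarrow> u' \<approx> v' \<Longrightarrow> u @ u' \<approx> v @ v'"
  unfolding eqv_def by (rule vagner.cong)

lemma eqv_regular: "w \<in> words \<Longrightarrow> w @ word_inv w @ w \<approx> w"
  by (simp add: eqv_def vagner.regular)

text \<open>In an inverse monoid the elements of this form are exactly the idempotents. The form
  makes the commuting relation of \<open>vagner\<close> directly applicable.\<close>

definition idem :: "'a letter list \<Rightarrow> bool" where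
  "idem e \<longleftrightarrow> (\<exists>u\<in>words. e \<approx> u @ word_inv u)"

lemma idem_words: "idem e \<Longrightarrow> e \<in> words"
  by (auto simp: idem_def dest: eqv_words)

lemma idem_inv: "u \<in> words \<Longrightarrow> idem (u @ word_inv u)"
  unfolding idem_def by (intro bexI[of _ u] eqv_refl) auto

lemma idem_commute:
  assumes "idem e" "idem f"
  shows "e @ f \<approx> f @ e"
proof -
  from assms obtain u v where u: "u \<in> words" "e \<approx> u @ word_inv u"
    and v: "v \<in> words" "f \<approx> v @ word_inv v"
    by (auto simp: idem_def)
  have "e @ f \<approx> (u @ word_inv u) @ (v @ word_inv v)"
    using u v by (intro eqv_append)
  also have "\<dots> \<approx> (v @ word_inv v) @ (u @ word_inv u)"
    using vagner.commute[OF u(1) v(1)] by (simp add: eqv_def)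
  also have "\<dots> \<approx> f @ e"
    by (rule eqv_append[OF eqv_sym[OF v(2)] eqv_sym[OF u(2)]])
  finally show ?thesis .
qed

lemma idem_square:
  assumes "idem e"
  shows "e @ e \<approx> e"
proof -
  from assms obtain u where u: "u \<in> words" "e \<approx> u @ word_inv u"
    by (auto simp: idem_def)
  have "e @ e \<approx> (u @ word_inv u) @ (u @ word_inv u)"
    using u by (intro eqv_append)
  also have "\<dots> \<approx> u @ word_inv u"
    using eqv_context[OF eqv_regular[OF u(1)], of "[]" "word_inv u"] u(1) by simp
  also have "\<dots> \<approx> e"
    by (rule eqv_sym[OF u(2)])
  finally show ?thesis .
qed

lemma idem_conj:
  assumes "idem e" "p \<in> words"
  shows "idem (p @ e @ word_inv p)"
proof -
  from assms obtain u where "u \<in> words" "e \<approx> u @ word_inv u"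
    by (auto simp: idem_def)
  then show ?thesis
    using assms(2) eqv_context[of e "u @ word_inv u" p "word_inv p"]
    by (auto simp: idem_def intro!: bexI[of _ "p @ u"])
qed

text \<open>The word \<open>?e = u @ word_inv u\<close> is its own formal inverse. Since
  \<open>?e @ ?f\<close> equals \<open>?e @ ?f @ ?e\<close> by commutation, it has the required form
  with \<open>?e @ v\<close> in the role of \<open>u\<close>.\<close>

lemma idem_append:
  assumes "idem e" "idem f"
  shows "idem (e @ f)"
proof -
  from assms obtain u v where u: "u \<in> words" "e \<approx> u @ word_inv u"
    and v: "v \<in> words" "f \<approx> v @ word_inv v"
    by (auto simp: idem_def)
  let ?e = "u @ word_inv u" and ?f = "v @ word_inv v"
  have idem: "idem ?e" "idem ?f" using u v by (simp_all add: idem_inv)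
  have "e @ f \<approx> ?e @ ?f" using u v by (intro eqv_append)
  also have "\<dots> \<approx> (?e @ ?e) @ ?f"
    using u v eqv_append[OF eqv_sym[OF idem_square[OF idem(1)]] eqv_refl, of ?f] by simp
  also have "(?e @ ?e) @ ?f = ?e @ ?e @ ?f" by simp
  also have "\<dots> \<approx> ?e @ ?f @ ?e"
    using u v by (intro eqv_append[OF eqv_refl idem_commute[OF idem]]) auto
  also have "\<dots> = (?e @ v) @ word_inv (?e @ v)" by simp
  finally show ?thesis
    unfolding idem_def using u v by (intro bexI[of _ "?e @ v"]) auto
qed

lemma conjugate_FIM_iff:
  assumes "u \<in> words" "v \<in> words"
  shows "conjugate (FIM X) (fim_proj X u) (fim_proj X v) \<longleftrightarrow>
    (\<exists>g\<in>words. word_inv g @ u @ g \<approx> v \<and> g @ v @ word_inv g \<approx> u)"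
  using assms
  by (simp add: conjugate_def carrier_FIM sinv_FIM mult_FIM fim_proj_eq_iff eqv_def)

lemma conjugate_FIM_sym:
  assumes "u \<in> words" "v \<in> words" "conjugate (FIM X) (fim_proj X u) (fim_proj X v)"
  shows "conjugate (FIM X) (fim_proj X v) (fim_proj X u)"
proof -
  from assms obtain g where "g \<in> words" "word_inv g @ u @ g \<approx> v" "g @ v @ word_inv g \<approx> u"
    by (auto simp: conjugate_FIM_iff)
  then show ?thesis
    using assms(1,2) by (auto simp: conjugate_FIM_iff intro!: bexI[of _ "word_inv g"])
qed

lemma conjugate_FIM_trans:
  assumes "u \<in> words" "v \<in> words" "w \<in> words"
    and "conjugate (FIM X) (fim_proj X u) (fim_proj X v)"
    and "conjugate (FIM X) (fim_proj X v) (fim_proj X w)"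
  shows "conjugate (FIM X) (fim_proj X u) (fim_proj X w)"
proof -
  from assms obtain g where g: "g \<in> words" "word_inv g @ u @ g \<approx> v" "g @ v @ word_inv g \<approx> u"
    by (auto simp: conjugate_FIM_iff)
  from assms obtain h where h: "h \<in> words" "word_inv h @ v @ h \<approx> w" "h @ w @ word_inv h \<approx> v"
    by (auto simp: conjugate_FIM_iff)
  have "word_inv (g @ h) @ u @ (g @ h) \<approx> w"
    using eqv_context[OF g(2), of "word_inv h" h] h eqv_trans by fastforce
  moreover have "(g @ h) @ w @ word_inv (g @ h) \<approx> u"
    using eqv_context[OF h(3), of g "word_inv g"] g eqv_trans by fastforce
  moreover have "g @ h \<in> words" using g h by simp
  ultimately show ?thesis using assms(1,3) conjugate_FIM_iff by blast
qed

lemma conjugate_FIM_refl: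
  assumes "u \<in> words"
  shows "conjugate (FIM X) (fim_proj X u) (fim_proj X u)"
  using assms by (auto simp: conjugate_FIM_iff intro!: bexI[of _ "[]"] eqv_refl)

text \<open>Classes can be compared through one pair of elements because conjugacy is an equivalence
  relation.\<close>

lemma conj_class_FIM_eq_iff:
  assumes "u \<in> words" "v \<in> words"
  shows "conj_class (FIM X) (fim_proj X u) = conj_class (FIM X) (fim_proj X v) \<longleftrightarrow>
    conjugate (FIM X) (fim_proj X u) (fim_proj X v)"
proof
  assume "conj_class (FIM X) (fim_proj X u) = conj_class (FIM X) (fim_proj X v)"
  moreover have "fim_proj X v \<in> conj_class (FIM X) (fim_proj X v)"
    using assms conjugate_FIM_refl by (simp add: conj_class_def carrier_FIM)
  ultimately show "conjugate (FIM X) (fim_proj X u) (fim_proj X v)"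
    by (auto simp: conj_class_def)
next
  assume "conjugate (FIM X) (fim_proj X u) (fim_proj X v)"
  then have "conjugate (FIM X) (fim_proj X u) (fim_proj X w) \<longleftrightarrow>
      conjugate (FIM X) (fim_proj X v) (fim_proj X w)" if "w \<in> words" for w
    using conjugate_FIM_trans[OF assms that] conjugate_FIM_trans[OF assms(2,1) that]
      conjugate_FIM_sym[OF assms] by blast
  then show "conj_class (FIM X) (fim_proj X u) = conj_class (FIM X) (fim_proj X v)"
    by (auto simp: conj_class_def carrier_FIM)
qed

text \<open>Equal elements are conjugate, so minimality over the conjugacy class already contains
  the condition of \<open>Geo\<close>.\<close>

lemma ConjGeo_iff:
  "w \<in> ConjGeo X \<longleftrightarrow> w \<in> words \<and>
    (\<forall>x\<in>words. conjugate (FIM X) (fim_proj X w) (fim_proj X x) \<longrightarrow> length w \<le> length x)"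
  unfolding ConjGeo_def Geo_def by (auto simp: conj_class_FIM_eq_iff conjugate_FIM_refl)

end

section \<open>Normal forms of comb words and their shorter conjugates\<close>

section \<open>Combs: an axis with teeth\<close>

locale comb = free_inverse X for X :: "'a set" +
  fixes a b :: 'a
  assumes a: "a \<in> X" and b: "b \<in> X" and ab: "a \<noteq> b"
begin

abbreviation up :: "nat \<Rightarrow> 'a letter list" where "up n \<equiv> replicate n (Gen b)"
abbreviation down :: "nat \<Rightarrow> 'a letter list" where "down n \<equiv> replicate n (Inv b)"
abbreviation tooth :: "'a letter list" where "tooth \<equiv> [Gen a, Inv a]"
abbreviation tooth_at :: "nat \<Rightarrow> 'a letter list" where "tooth_at n \<equiv> up n @ tooth @ down n"

lemma letters_ab [simp]:
  "Gen a \<in> letters X" "Inv a \<in> letters X" "Gen b \<in> letters X" "Inv b \<in> letters X"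
  using a b by (auto simp: letters_def)

lemma up_words [simp]: "up n \<in> words" "down n \<in> words"
  by (auto simp: in_lists_conv_set)

lemma idem_tooth: "idem tooth"
  using idem_inv[of "[Gen a]"] by simp

lemma idem_tooth_at: "idem (tooth_at n)"
  using idem_conj[OF idem_tooth up_words(1), of n] by simp

lemma idem_up_down: "idem (up n @ down n)" "idem (down n @ up n)"
  using idem_inv[of "up n"] idem_inv[of "down n"] by simp_all

lemma up_down_up: "up n @ down n @ up n \<approx> up n"
  using eqv_regular[of "up n"] by simp

lemma down_up_down: "down n @ up n @ down n \<approx> down n"
  using eqv_regular[of "down n"] by simp

text \<open>Inserting \<open>down n @ up n\<close> after \<open>up n\<close> and commuting it with
  the tooth moves the tooth to the front, as an idempotent based at 0.\<close>

lemma up_tooth: "up n @ tooth \<approx> tooth_at n @ up n"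
proof -
  have "up n @ tooth \<approx> (up n @ down n @ up n) @ tooth"
    by (intro eqv_append eqv_sym[OF up_down_up] eqv_refl) simp
  also have "(up n @ down n @ up n) @ tooth = up n @ (down n @ up n) @ tooth" by simp
  also have "\<dots> \<approx> up n @ tooth @ (down n @ up n)"
    by (intro eqv_append eqv_refl idem_commute idem_tooth idem_up_down) simp
  finally show ?thesis by simp
qed

text \<open>The path \<open>up n @ down (n - q)\<close> ends at height \<open>q\<close>, and by
  \<open>tooth @ s \<approx> s\<close> the word \<open>s\<close> already contains the tooth there.
  So the tooth in front adds no edge to the Munn tree.\<close>

lemma tooth_absorb:
  assumes "q \<le> n" "s \<in> words" "tooth @ s \<approx> s"
  shows "tooth_at q @ up n @ down (n - q) @ s \<approx> up n @ down (n - q) @ s"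
proof -
  let ?d = "up (n - q) @ down (n - q)"
  have n: "up n = up q @ up (n - q)"
    using assms(1) by (simp flip: replicate_add)
  have "tooth_at q @ up n @ down (n - q) @ s = up q @ (tooth @ (down q @ up q) @ ?d) @ s"
    by (simp add: n)
  also have "\<dots> \<approx> up q @ (((down q @ up q) @ ?d) @ tooth) @ s"
    using assms by (intro eqv_context idem_commute idem_tooth idem_append idem_up_down) auto
  also have "\<dots> = (up q @ down q @ up q) @ ?d @ tooth @ s" by simp
  also have "\<dots> \<approx> up q @ ?d @ s"
    using assms by (intro eqv_append[OF up_down_up] eqv_append eqv_refl) auto
  finally show ?thesis by (simp add: n)
qed

lemma tooth_Gen: "tooth @ [Gen a] \<approx> [Gen a]"
  using eqv_regular[of "[Gen a]"] by simp

text \<open>The interval has been traversed by \<open>up n\<close> before, so the turn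
  \<open>down j @ up j\<close> is an idempotent that can be moved next to \<open>up j\<close> and
  absorbed.\<close>

lemma up_down_back:
  assumes "j \<le> r" "r \<le> n"
  shows "up n @ down r @ up j \<approx> up n @ down (r - j)"
proof -
  let ?d = "up (r - j) @ down (r - j)"
  have n: "up n = up (n - r) @ up j @ up (r - j)" and r: "down r = down (r - j) @ down j"
    using assms by (simp_all flip: replicate_add)
  have "up n @ down r @ up j = (up (n - r) @ up j) @ ?d @ (down j @ up j)"
    by (simp add: n r)
  also have "\<dots> \<approx> (up (n - r) @ up j) @ (down j @ up j) @ ?d"
    by (intro eqv_append eqv_refl idem_commute idem_up_down) auto
  also have "\<dots> = up (n - r) @ (up j @ down j @ up j) @ ?d" by simp
  also have "\<dots> \<approx> up (n - r) @ up j @ ?d"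
    by (intro eqv_context up_down_up) auto
  finally show ?thesis by (simp add: n)
qed

text \<open>Seen from the end \<open>m\<close> of \<open>up n @ down (n - m)\<close>, a tooth at
  relative height \<open>t\<close> has absolute height \<open>t + m\<close>. The bound
  \<open>t + m \<le> n\<close> keeps the way to it inside the axis already traversed.\<close>

lemma tooth_translate:
  assumes "t + m \<le> n"
  shows "up n @ down (n - m) @ tooth_at t \<approx> tooth_at (t + m) @ up n @ down (n - m)"
proof -
  let ?q = "t + m"
  have r: "down (n - m) = down (n - ?q) @ down t"
    using assms by (simp flip: replicate_add)
  have "up n @ down (n - m) @ tooth_at t
      = (up n @ down (n - ?q)) @ ((down t @ up t) @ tooth) @ down t"
    by (simp add: r)
  also have "\<dots> \<approx> (up n @ down (n - ?q)) @ (tooth @ (down t @ up t)) @ down t"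
    by (intro eqv_context idem_commute idem_tooth idem_up_down) auto
  also have "\<dots> = (up n @ down (n - ?q) @ tooth) @ (down t @ up t @ down t)" by simp
  also have "\<dots> \<approx> (up n @ down (n - ?q) @ tooth) @ down t"
    by (intro eqv_append[OF eqv_refl] down_up_down) simp
  finally have 1: "up n @ down (n - m) @ tooth_at t \<approx> up n @ down (n - ?q) @ tooth @ down t"
    by simp
  \<comment> \<open>A copy of the tooth may be put in front because the word crosses it later. In 3
    the later crossing is then dropped as redundant.\<close>
  have 2: "tooth_at ?q @ up n @ down (n - ?q) @ tooth @ down t
      \<approx> up n @ down (n - ?q) @ tooth @ down t"
    using assms eqv_append[OF idem_square[OF idem_tooth] eqv_refl, of "down t"]
    by (intro tooth_absorb) auto
  have 3: "tooth_at ?q @ up n @ down (n - ?q) @ tooth @ down t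
      \<approx> tooth_at ?q @ up n @ down (n - ?q) @ down t"
  proof -
    let ?d = "up (n - ?q) @ down (n - ?q)"
    have n: "up n = up ?q @ up (n - ?q)"
      using assms by (simp flip: replicate_add)
    have "tooth_at ?q @ up n @ down (n - ?q) @ tooth @ down t
        = up ?q @ (tooth @ ((down ?q @ up ?q) @ ?d)) @ tooth @ down t"
      by (simp add: n)
    also have "\<dots> \<approx> up ?q @ (((down ?q @ up ?q) @ ?d) @ tooth) @ tooth @ down t"
      by (intro eqv_context idem_commute idem_tooth idem_append idem_up_down) auto
    also have "\<dots> = (up ?q @ (down ?q @ up ?q) @ ?d) @ (tooth @ tooth) @ down t" by simp
    also have "\<dots> \<approx> (up ?q @ (down ?q @ up ?q) @ ?d) @ tooth @ down t"
      by (intro eqv_context idem_square idem_tooth) auto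
    also have "\<dots> = up ?q @ (((down ?q @ up ?q) @ ?d) @ tooth) @ down t" by simp
    also have "\<dots> \<approx> up ?q @ (tooth @ ((down ?q @ up ?q) @ ?d)) @ down t"
      by (intro eqv_context idem_commute idem_tooth idem_append idem_up_down) auto
    finally show ?thesis by (simp add: n)
  qed
  show ?thesis
    using eqv_trans[OF 1 eqv_trans[OF eqv_sym[OF 2] 3]] by (simp add: r)
qed

text \<open>The conjugator \<open>up t @ [Gen a]\<close> leads to the tip of the tooth at
  \<open>t\<close>, and the endpoint moves to the tip of the tooth at \<open>t + m\<close>. The new
  word therefore needs these two teeth only as its first and last letter. \<open>e\<close> collects
  the other teeth, and \<open>v\<close> is any word that draws them and ends at height
  \<open>n\<close>.\<close>

lemma comb_conjugate:
  assumes w: "w \<approx> tooth_at t @ tooth_at (t + m) @ e @ up n @ down (n - m)"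
    and e: "idem e" and le: "t + m \<le> n" and v: "v \<approx> e @ up n"
  shows "conjugate (FIM X) (fim_proj X w)
    (fim_proj X ([Inv a] @ down t @ v @ down (n - (t + m)) @ [Gen a]))"
proof -
  let ?q = "t + m" and ?g = "up t @ [Gen a]"
  let ?g' = "[Inv a] @ down t"
  let ?w = "tooth_at t @ tooth_at ?q @ e @ up n @ down (n - m)"
  let ?s = "?g' @ v @ down (n - ?q) @ [Gen a]"
  have e': "e \<in> words" using e by (rule idem_words)
  have words: "?g \<in> words" "?g' \<in> words" "w \<in> words" "v \<in> words"
    using eqv_words[OF w] eqv_words[OF v] by auto
  have "?g' @ w @ ?g \<approx> ?g' @ ?w @ ?g"
    using w words by (intro eqv_context)
  also have "\<dots> = (?g' @ tooth_at t @ tooth_at ?q @ e) @ (up n @ down (n - m) @ up t) @ [Gen a]"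
    by simp
  also have "\<dots> \<approx> (?g' @ tooth_at t @ tooth_at ?q @ e) @ (up n @ down (n - m - t)) @ [Gen a]"
    using e' le by (intro eqv_context up_down_back) auto
  \<comment> \<open>\<open>word_inv ?g' @ ?g'\<close> is \<open>tooth_at t\<close>, so this tooth
    disappears by regularity.\<close>
  also have "\<dots> = (?g' @ word_inv ?g' @ ?g') @ (tooth_at ?q @ e) @ up n @ down (n - ?q) @ [Gen a]"
    by (simp add: add.commute)
  also have "\<dots> \<approx> ?g' @ (tooth_at ?q @ e) @ up n @ down (n - ?q) @ [Gen a]"
    using e' by (intro eqv_append[OF eqv_regular eqv_refl]) auto
  also have "\<dots> \<approx> ?g' @ (e @ tooth_at ?q) @ up n @ down (n - ?q) @ [Gen a]"
    using e by (intro eqv_context idem_commute idem_tooth_at) auto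
  also have "\<dots> = (?g' @ e) @ (tooth_at ?q @ up n @ down (n - ?q) @ [Gen a])" by simp
  also have "\<dots> \<approx> (?g' @ e) @ (up n @ down (n - ?q) @ [Gen a])"
    using e' le by (intro eqv_append[OF eqv_refl] tooth_absorb tooth_Gen) auto
  also have "\<dots> = ?g' @ (e @ up n) @ (down (n - ?q) @ [Gen a])" by simp
  also have "\<dots> \<approx> ?g' @ v @ (down (n - ?q) @ [Gen a])"
    using eqv_sym[OF v] by (rule eqv_context) auto
  finally have 1: "?g' @ w @ ?g \<approx> ?s" by simp
  \<comment> \<open>For the way back, \<open>?g @ ?g'\<close> is \<open>tooth_at t\<close>. Its left
    copy is absorbed as an idempotent; its right copy becomes a second tooth at \<open>?q\<close> by
    \<open>tooth_translate\<close>.\<close>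
  have "?g @ ?s @ ?g' \<approx> ?g @ (?g' @ w @ ?g) @ ?g'"
    by (rule eqv_context[OF eqv_sym[OF 1]]) auto
  also have "\<dots> = tooth_at t @ w @ tooth_at t" by simp
  also have "\<dots> \<approx> tooth_at t @ ?w @ tooth_at t"
    using w by (intro eqv_context) auto
  also have "\<dots> = (tooth_at t @ tooth_at t) @ (tooth_at ?q @ e) @ (up n @ down (n - m) @ tooth_at t)"
    by simp
  also have "\<dots> \<approx> tooth_at t @ (e @ tooth_at ?q) @ (tooth_at ?q @ up n @ down (n - m))"
    using e le
    by (intro eqv_append idem_square idem_commute idem_tooth_at tooth_translate)
  also have "\<dots> = (tooth_at t @ e) @ (tooth_at ?q @ tooth_at ?q) @ up n @ down (n - m)" by simp
  also have "\<dots> \<approx> (tooth_at t @ e) @ tooth_at ?q @ up n @ down (n - m)"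
    using e' by (intro eqv_context idem_square idem_tooth_at) auto
  also have "\<dots> = tooth_at t @ (e @ tooth_at ?q) @ up n @ down (n - m)" by simp
  also have "\<dots> \<approx> tooth_at t @ (tooth_at ?q @ e) @ up n @ down (n - m)"
    using e by (intro eqv_context idem_commute idem_tooth_at) auto
  also have "\<dots> \<approx> w" using eqv_sym[OF w] by simp
  finally have 2: "?g @ ?s @ ?g' \<approx> w" .
  have g: "word_inv ?g = ?g'" by simp
  have "?s \<in> words" using words by auto
  moreover have "\<exists>g\<in>words. word_inv g @ w @ g \<approx> ?s \<and> g @ ?s @ word_inv g \<approx> w"
    using 1 2 words(1) unfolding g[symmetric] by blast
  ultimately show ?thesis
    using conjugate_FIM_iff[of w ?s] words(3) by simp
qed

text \<open>Words are read from the left in the form \<open>e @ up i\<close>, an idempotent part and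
  a current height. Reading a tooth changes only the idempotent part.\<close>

lemma comb_tooth:
  assumes "u \<approx> e @ up i"
  shows "u @ tooth \<approx> (e @ tooth_at i) @ up i"
proof -
  have "e \<in> words" using eqv_words(2)[OF assms] by simp
  have "u @ tooth \<approx> (e @ up i) @ tooth"
    using assms by (intro eqv_append eqv_refl) auto
  also have "\<dots> = e @ up i @ tooth" by simp
  also have "\<dots> \<approx> e @ tooth_at i @ up i"
    using \<open>e \<in> words\<close> by (intro eqv_append eqv_refl up_tooth)
  finally show ?thesis by simp
qed

lemma comb_up:
  assumes "u \<approx> e @ up i"
  shows "u @ up j \<approx> e @ up (i + j)"
  using eqv_append[OF assms eqv_refl, of "up j"] by (simp add: replicate_add)

definition comb_word :: "nat \<Rightarrow> nat \<Rightarrow> nat \<Rightarrow> nat \<Rightarrow> 'a letter list" where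
  "comb_word c1 c2 c3 r = tooth @ up c1 @ tooth @ up c2 @ tooth @ up c3 @ tooth @ down r"

lemma comb_word_words: "comb_word c1 c2 c3 r \<in> words"
  by (auto simp: comb_word_def)

lemma comb_word_eqv:
  "comb_word c1 c2 c3 r \<approx> tooth_at 0 @ tooth_at c1 @ tooth_at (c1 + c2) @ tooth_at (c1 + c2 + c3)
    @ up (c1 + c2 + c3) @ down r"
proof -
  have "[] \<approx> [] @ up 0" by (simp add: eqv_refl)
  from comb_tooth[OF comb_up[OF comb_tooth[OF comb_up[OF comb_tooth[OF comb_up[OF comb_tooth[OF this],
    of c1]], of c2]], of c3]]
  show ?thesis
    unfolding comb_word_def using eqv_append[OF _ eqv_refl[of "down r"]] by fastforce
qed

text \<open>The final height \<open>?n - r\<close> is \<open>c3\<close>, \<open>c2\<close> or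
  \<open>c1\<close>, the distance between the last, middle or first two neighbouring teeth.
  \<open>comb_conjugate\<close> applies to that pair.\<close>

lemma comb_word_not_ConjGeo:
  assumes r: "r = c1 + c2 \<or> r = c1 + c3 \<or> r = c2 + c3"
  shows "comb_word c1 c2 c3 r \<notin> ConjGeo X"
proof -
  let ?n = "c1 + c2 + c3"
  have nil: "[] \<approx> [] @ up 0" by (simp add: eqv_refl)
  have cw: "length (comb_word c1 c2 c3 r) = 8 + ?n + r" by (simp add: comb_word_def)
  \<comment> \<open>\<open>v\<close> draws the two remaining teeth on the way to \<open>?n\<close>,
    hence the length \<open>?n + 4\<close>. The conjugate has length \<open>6 + ?n + r\<close>, two
    less than the comb word.\<close>
  have notin: "comb_word c1 c2 c3 r \<notin> ConjGeo X"
    if w: "comb_word c1 c2 c3 r \<approx> tooth_at t @ tooth_at (t + m) @ e @ up ?n @ down (?n - m)"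
      and m: "r = ?n - m" "t + m \<le> ?n" and e: "idem e" and v: "v \<approx> e @ up ?n"
      and len: "length v = ?n + 4" for t m e v
  proof -
    let ?s = "[Inv a] @ down t @ v @ down (?n - (t + m)) @ [Gen a]"
    have "conjugate (FIM X) (fim_proj X (comb_word c1 c2 c3 r)) (fim_proj X ?s)"
      using w e m(2) v by (rule comb_conjugate)
    moreover have "?s \<in> words" using eqv_words[OF v] by auto
    moreover have "length ?s < length (comb_word c1 c2 c3 r)"
      using m len cw by simp
    ultimately show ?thesis unfolding ConjGeo_iff by fastforce
  qed
  note J = idem_tooth_at and W = idem_words[OF idem_tooth_at]
  from r show ?thesis
  proof (elim disjE)
    assume r: "r = c1 + c2"
    let ?t = "c1 + c2"
    have "comb_word c1 c2 c3 r
        \<approx> (tooth_at 0 @ tooth_at c1) @ (tooth_at ?t @ tooth_at ?n) @ up ?n @ down r"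
      using comb_word_eqv by simp
    also have "\<dots> = [] @ ((tooth_at 0 @ tooth_at c1) @ (tooth_at ?t @ tooth_at ?n)) @ up ?n @ down r"
      by simp
    also have "\<dots> \<approx> [] @ ((tooth_at ?t @ tooth_at ?n) @ (tooth_at 0 @ tooth_at c1)) @ up ?n @ down r"
      by (intro eqv_context idem_commute idem_append J) auto
    finally have 1: "comb_word c1 c2 c3 r
        \<approx> tooth_at ?t @ tooth_at (?t + c3) @ (tooth_at 0 @ tooth_at c1) @ up ?n @ down (?n - c3)"
      using r by simp
    show ?thesis
    proof (rule notin[OF 1])
      show "idem (tooth_at 0 @ tooth_at c1)" by (intro idem_append J)
      show "((([] @ tooth) @ up c1) @ tooth) @ up (c2 + c3) \<approx> (tooth_at 0 @ tooth_at c1) @ up ?n"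
        using comb_up[OF comb_tooth[OF comb_up[OF comb_tooth[OF nil], of c1]], of "c2 + c3"]
        by (simp add: add.assoc)
    qed (use r in auto)
  next
    assume r: "r = c1 + c3"
    have "comb_word c1 c2 c3 r
        \<approx> [] @ (tooth_at 0 @ (tooth_at c1 @ tooth_at (c1 + c2))) @ tooth_at ?n @ up ?n @ down r"
      using comb_word_eqv by simp
    also have "\<dots> \<approx> [] @ ((tooth_at c1 @ tooth_at (c1 + c2)) @ tooth_at 0) @ tooth_at ?n @ up ?n @ down r"
      by (intro eqv_context idem_commute idem_append J) auto
    finally have 1: "comb_word c1 c2 c3 r
        \<approx> tooth_at c1 @ tooth_at (c1 + c2) @ (tooth_at 0 @ tooth_at ?n) @ up ?n @ down (?n - c2)"
      using r by simp
    show ?thesis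
    proof (rule notin[OF 1])
      show "idem (tooth_at 0 @ tooth_at ?n)" by (intro idem_append J)
      show "(([] @ tooth) @ up ?n) @ tooth \<approx> (tooth_at 0 @ tooth_at ?n) @ up ?n"
        using comb_tooth[OF comb_up[OF comb_tooth[OF nil], of ?n]] by simp
    qed (use r in auto)
  next
    assume r: "r = c2 + c3"
    have 1: "comb_word c1 c2 c3 r
        \<approx> tooth_at 0 @ tooth_at (0 + c1) @ (tooth_at (c1 + c2) @ tooth_at ?n) @ up ?n @ down (?n - c1)"
      using comb_word_eqv[of c1 c2 c3 r] r by simp
    show ?thesis
    proof (rule notin[OF 1])
      show "idem (tooth_at (c1 + c2) @ tooth_at ?n)" by (intro idem_append J)
      show "((([] @ up (c1 + c2)) @ tooth) @ up c3) @ tooth \<approx> (tooth_at (c1 + c2) @ tooth_at ?n) @ up ?n"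
        using comb_tooth[OF comb_up[OF comb_tooth[OF comb_up[OF nil, of "c1 + c2"]], of c3]] by simp
    qed (use r in auto)
  qed
qed

end

section \<open>Partial actions as invariants of the Vagner classes\<close>

section \<open>Words acting on a graph\<close>

primrec run :: "('l \<Rightarrow> 'v \<Rightarrow> 'v option) \<Rightarrow> 'l list \<Rightarrow> 'v \<Rightarrow> 'v option" where
  "run st [] p = Some p"
| "run st (l # w) p = Option.bind (st l p) (run st w)"

lemma run_append: "run st (u @ v) p = Option.bind (run st u p) (run st v)"
  by (induction u arbitrary: p) (auto split: bind_splits)

text \<open>The first edge of the run that \<open>st'\<close> lacks touches a vertex with
  \<open>P\<close>. For a comb shortened at one end, this forces a visit to that end.\<close>

lemma run_visit:
  assumes "\<And>l p q. st l p = Some q \<Longrightarrow> st' l p = Some q \<or> P p \<or> P q"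
    and "run st x p = Some p'" "run st' x p = None"
  shows "\<exists>x1 x2 q. x = x1 @ x2 \<and> run st x1 p = Some q \<and> P q"
  using assms(2,3)
proof (induction x arbitrary: p)
  case (Cons l x)
  then obtain q where q: "st l p = Some q" "run st x q = Some p'"
    by (auto split: bind_splits)
  from assms(1)[OF q(1)] show ?case
  proof (elim disjE)
    assume "st' l p = Some q"
    with Cons.prems have "run st' x q = None" by simp
    from Cons.IH[OF q(2) this] obtain x1 x2 q' where "x = x1 @ x2" "run st x1 q = Some q'" "P q'"
      by blast
    with q(1) show ?thesis by (intro exI[of _ "l # x1"] exI[of _ x2] exI[of _ q']) simp
  next
    assume "P p"
    then show ?thesis by (intro exI[of _ "[]"] exI[of _ "l # x"] exI[of _ p]) simp
  next
    assume "P q"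
    with q(1) show ?thesis by (intro exI[of _ "[l]"] exI[of _ x] exI[of _ q]) simp
  qed
qed simp

text \<open>Letters act by partial injections and formal inverses by the inverse maps, as in an
  inverse automaton. Such an action respects the Vagner congruence.\<close>

locale inverse_action =
  fixes st :: "'a letter \<Rightarrow> 'v \<Rightarrow> 'v option"
  assumes st_inv: "st l p = Some q \<Longrightarrow> st (letter_inv l) q = Some p"
begin

lemma run_word_inv: "run st w p = Some q \<Longrightarrow> run st (word_inv w) q = Some p"
proof (induction w arbitrary: p)
  case (Cons l w)
  then obtain r where "st l p = Some r" "run st w r = Some q"
    by (auto split: bind_splits)
  with Cons.IH st_inv show ?case by (simp add: run_append)
qed simp

lemma run_idem: "run st (u @ word_inv u) p = (if run st u p = None then None else Some p)"
  by (auto simp: run_append run_word_inv)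

lemma run_vagner: "(u, v) \<in> vagner X \<Longrightarrow> run st u p = run st v p"
proof (induction arbitrary: p rule: vagner.induct)
  case (regular w)
  show ?case
    using run_word_inv[of w p] by (cases "run st w p") (simp_all add: run_append)
next
  case (commute u v)
  have "run st ((u @ word_inv u) @ (v @ word_inv v)) p
      = run st ((v @ word_inv v) @ (u @ word_inv u)) p"
    unfolding run_append[of st "_ @ word_inv _"] run_idem by simp
  then show ?case by simp
next
  case (cong u v u' v')
  then have "run st u' = run st v'" by blast
  with cong show ?case by (simp add: run_append)
qed simp_all

end

section \<open>Runs in comb graphs and lower bounds on their length\<close>

context comb
begin

text \<open>The vertex \<open>(i, False)\<close> is the point \<open>i\<close> of the axis, \<open>(i, True)\<close> is the tip of the tooth at \<open>i\<close>.\<close>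

fun graph :: "int \<Rightarrow> int \<Rightarrow> int set \<Rightarrow> 'a letter \<Rightarrow> int \<times> bool \<Rightarrow> (int \<times> bool) option" where
  "graph lo hi T l (i, t) =
    (if l = Gen b \<and> \<not> t \<and> lo \<le> i \<and> i < hi then Some (i + 1, False)
     else if l = Inv b \<and> \<not> t \<and> lo < i \<and> i \<le> hi then Some (i - 1, False)
     else if l = Gen a \<and> \<not> t \<and> i \<in> T then Some (i, True)
     else if l = Inv a \<and> t \<and> i \<in> T then Some (i, False)
     else None)"

lemma inverse_action_graph: "inverse_action (graph lo hi T)"
proof
  fix l p q
  assume "graph lo hi T l p = Some q"
  then show "graph lo hi T (letter_inv l) q = Some p"
    using ab by (cases p; cases l) (auto split: if_splits)
qed

lemmas run_eqv = inverse_action.run_vagner[OF inverse_action_graph]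
lemmas run_graph_inv = inverse_action.run_word_inv[OF inverse_action_graph]

lemma run_graph_mono:
  assumes "run (graph lo' hi' T') x p = Some q" "lo \<le> lo'" "hi' \<le> hi" "T' \<subseteq> T"
  shows "run (graph lo hi T) x p = Some q"
  using assms(1)
proof (induction x arbitrary: p)
  case (Cons l x)
  then obtain r where r: "graph lo' hi' T' l p = Some r" "run (graph lo' hi' T') x r = Some q"
    by (auto split: bind_splits)
  have "graph lo hi T l p = Some r"
    using r(1) assms(2-) ab by (cases p) (auto split: if_splits)
  with r(2) Cons.IH show ?case by simp
qed simp

text \<open>The case \<open>n = 0\<close> is separate because the empty word runs from every vertex,
  even from outside the interval.\<close>

lemma run_up:
  "run (graph lo hi T) (up n) (i, False) =
    (if n = 0 \<or> lo \<le> i \<and> i + int n \<le> hi then Some (i + int n, False) else None)"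
  using ab by (induction n arbitrary: i) (auto simp: algebra_simps)

lemma run_down:
  "run (graph lo hi T) (down n) (i, False) =
    (if n = 0 \<or> i \<le> hi \<and> lo \<le> i - int n then Some (i - int n, False) else None)"
  using ab by (induction n arbitrary: i) (auto simp: algebra_simps)

lemma run_tooth:
  "run (graph lo hi T) (Gen a # Inv a # w) (i, False) =
    (if i \<in> T then run (graph lo hi T) w (i, False) else None)"
  using ab by simp

lemma run_displacement:
  "run (graph lo hi T) x (i, s) = Some (j, t) \<Longrightarrow>
    \<bar>j - i\<bar> \<le> int (count_list x (Gen b) + count_list x (Inv b))"
proof (induction x arbitrary: i s)
  case (Cons l x)
  then obtain i' s' where r: "graph lo hi T l (i, s) = Some (i', s')"
    "run (graph lo hi T) x (i', s') = Some (j, t)"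
    by (auto split: bind_splits)
  from Cons.IH[OF r(2)] r(1) ab show ?case by (auto split: if_splits)
qed simp

lemma run_teeth_balance:
  "run (graph lo hi T) x p = Some q \<Longrightarrow>
    of_bool (snd p) + count_list x (Gen a) = of_bool (snd q) + count_list x (Inv a)"
proof (induction x arbitrary: p)
  case (Cons l x)
  then obtain r where r: "graph lo hi T l p = Some r" "run (graph lo hi T) x r = Some q"
    by (auto split: bind_splits)
  from Cons.IH[OF r(2)] r(1) ab show ?case by (cases p) (auto split: if_splits)
qed simp

text \<open>\<open>D\<close> consists of teeth whose removal destroys the run. Each must be entered
  by a \<open>Gen a\<close> of its own, as reading \<open>Gen a\<close> at \<open>p\<close> enters
  only the tooth at \<open>fst p\<close>. The condition \<open>p \<noteq> (t, True)\<close> excludes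
  a start at the tip, where no entry would be forced.\<close>

lemma run_teeth_count:
  assumes "run (graph lo hi T) x p = Some q" "finite D"
    and "\<And>t. t \<in> D \<Longrightarrow> p \<noteq> (t, True) \<and> run (graph lo hi (T - {t})) x p = None"
  shows "card D \<le> count_list x (Gen a)"
  using assms
proof (induction x arbitrary: p D)
  case Nil
  then have "D = {}" by fastforce
  then show ?case by simp
next
  case (Cons l x)
  then obtain r where r: "graph lo hi T l p = Some r" "run (graph lo hi T) x r = Some q"
    by (auto split: bind_splits)
  define D' where "D' = (if l = Gen a then D - {fst p} else D)"
  have "card D' \<le> count_list x (Gen a)"
  proof (rule Cons.IH[OF r(2)])
    show "finite D'" using Cons.prems(2) by (simp add: D'_def)
    fix t
    assume "t \<in> D'"
    then have t: "t \<in> D" "l = Gen a \<Longrightarrow> t \<noteq> fst p" by (auto simp: D'_def split: if_splits)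
    with Cons.prems(3) have p: "p \<noteq> (t, True)" "run (graph lo hi (T - {t})) (l # x) p = None" by auto
    have "graph lo hi (T - {t}) l p = Some r"
      using r(1) t(2) p(1) by (cases p) (auto split: if_splits)
    moreover have "r \<noteq> (t, True)"
      using r(1) t(2) by (cases p) (auto split: if_splits)
    ultimately show "r \<noteq> (t, True) \<and> run (graph lo hi (T - {t})) x r = None"
      using p(2) by simp
  qed
  moreover have "card D \<le> Suc (card (D - {fst p}))"
    using Cons.prems(2) by (metis card_Suc_Diff1 card_mono finite_Diff insert_Diff_single le_Suc_eq
        order.refl Diff_empty Diff_insert0)
  ultimately show ?case by (auto simp: D'_def split: if_splits)
qed

lemma count_letters_le_length:
  "count_list x (Gen a) + count_list x (Inv a) + count_list x (Gen b) + count_list x (Inv b) \<le> length x"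
  using ab by (induction x) auto

text \<open>The comb has \<open>S\<close> axis edges and \<open>card T\<close> teeth. The failure
  conditions force visits to both ends of the axis and to every tooth; each tooth costs two letters,
  since the run starts and ends on the axis.\<close>

lemma comb_tour_length:
  assumes run: "run (graph 0 S T) x (p, False) = Some (p + m, False)"
    and m: "0 \<le> m" and fin: "finite T"
    and left: "run (graph 1 S T) x (p, False) = None"
    and right: "run (graph 0 (S - 1) T) x (p, False) = None"
    and teeth: "\<And>t. t \<in> T \<Longrightarrow> run (graph 0 S (T - {t})) x (p, False) = None"
  shows "2 * int (card T) + 2 * S - m \<le> int (length x)"
proof -
  define steps where "steps x = int (count_list x (Gen b) + count_list x (Inv b))"
    for x :: "'a letter list"
  have steps_append: "steps (u @ v) = steps u + steps v" for u v
    by (simp add: steps_def)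
  have disp: "\<bar>j - i\<bar> \<le> steps u" if "run (graph 0 S T) u (i, s) = Some (j, t)" for u i j s t
    using run_displacement[OF that] by (simp add: steps_def)
  have tour: "\<bar>i - p\<bar> + \<bar>j - i\<bar> + \<bar>p + m - j\<bar> \<le> steps x"
    if "x = u @ v @ w" "run (graph 0 S T) u (p, False) = Some (i, s)"
      "run (graph 0 S T) (u @ v) (p, False) = Some (j, t)" for u v w i j s t
  proof -
    have v: "run (graph 0 S T) v (i, s) = Some (j, t)" using that by (simp add: run_append)
    have w: "run (graph 0 S T) w (j, t) = Some (p + m, False)"
      using that run by (metis append_assoc bind.bind_lunit run_append)
    show ?thesis
      using disp[OF that(2)] disp[OF v] disp[OF w] by (simp add: that(1) steps_append)
  qed
  have "\<exists>x1 x2 q. x = x1 @ x2 \<and> run (graph 0 S T) x1 (p, False) = Some q \<and> fst q = 0"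
    using run left by (rule run_visit[rotated 1]) (auto split: if_splits)
  then obtain x1 x2 s where x: "x = x1 @ x2" "run (graph 0 S T) x1 (p, False) = Some (0, s)"
    by auto
  have "\<exists>x1 x2 q. x = x1 @ x2 \<and> run (graph 0 S T) x1 (p, False) = Some q \<and> fst q = S"
    using run right by (rule run_visit[rotated 1]) (auto split: if_splits)
  then obtain y1 y2 t where y: "x = y1 @ y2" "run (graph 0 S T) y1 (p, False) = Some (S, t)"
    by auto
  \<comment> \<open>Visiting 0 first costs at least \<open>2 * S - m\<close> axis steps. Visiting
    \<open>S\<close> first costs at least \<open>2 * S + m\<close>, which suffices because
    \<open>0 \<le> m\<close>.\<close>
  from x(1) y(1) consider v where "y1 = x1 @ v" "x = x1 @ v @ y2"
    | v where "x1 = y1 @ v" "x = y1 @ v @ x2"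
    by (auto simp: append_eq_append_conv2)
  then have "2 * S - m \<le> steps x"
  proof cases
    case 1
    with tour[OF 1(2) x(2), of S t] y(2) show ?thesis by simp
  next
    case 2
    with tour[OF 2(2) y(2), of 0 s] x(2) m show ?thesis by simp
  qed
  moreover have "card T \<le> count_list x (Gen a)"
    using run_teeth_count[OF run fin] teeth by auto
  moreover have "count_list x (Gen a) = count_list x (Inv a)"
    using run_teeth_balance[OF run] by simp
  ultimately show ?thesis
    using count_letters_le_length[of x] by (simp add: steps_def)
qed

text \<open>Two copies of a run at distance \<open>m\<close> could leave the axis only together,
  through teeth at \<open>t\<close> and \<open>t + m\<close>. Without such a pair they stay on the
  axis and keep their distance.\<close>

lemma run_parallel:
  assumes "\<And>t. t \<in> T \<Longrightarrow> t + m \<notin> T"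
    and "run (graph lo hi T) g (i, False) = Some q" "run (graph lo hi T) g (i + m, False) = Some q'"
  shows "\<exists>j. q = (j, False) \<and> q' = (j + m, False)"
  using assms(2,3)
proof (induction g arbitrary: i)
  case (Cons l g)
  then obtain r r' where r: "graph lo hi T l (i, False) = Some r" "run (graph lo hi T) g r = Some q"
    and r': "graph lo hi T l (i + m, False) = Some r'" "run (graph lo hi T) g r' = Some q'"
    by (auto split: bind_splits simp del: graph.simps)
  from r(1) r'(1) assms(1) ab have "\<exists>i'. r = (i', False) \<and> r' = (i' + m, False)"
    by (auto split: if_splits)
  with Cons.IH r(2) r'(2) show ?case by blast
qed auto

text \<open>For a conjugate \<open>x\<close>, the conjugator \<open>g\<close> leads from 0 and
  \<open>m\<close> to two axis points at the same distance. Between these, \<open>x\<close> makes a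
  tour of the same comb, so \<open>comb_tour_length\<close> bounds its length from below by that of
  \<open>w\<close>.\<close>

lemma comb_ConjGeo:
  assumes w: "w \<in> words" "run (graph 0 S T) w (0, False) = Some (m, False)"
    and m: "0 \<le> m" and T: "finite T" "\<And>t. t \<in> T \<Longrightarrow> t + m \<notin> T"
    and left: "run (graph 1 S T) w (0, False) = None"
    and right: "run (graph 0 (S - 1) T) w (0, False) = None"
    and teeth: "\<And>t. t \<in> T \<Longrightarrow> run (graph 0 S (T - {t})) w (0, False) = None"
    and len: "int (length w) = 2 * int (card T) + 2 * S - m"
  shows "w \<in> ConjGeo X"
  unfolding ConjGeo_iff
proof (intro conjI ballI impI)
  fix x
  assume "x \<in> words" "conjugate (FIM X) (fim_proj X w) (fim_proj X x)"
  with w(1) obtain g where g: "word_inv g @ w @ g \<approx> x" "g @ x @ word_inv g \<approx> w"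
    by (auto simp: conjugate_FIM_iff)
  have "run (graph 0 S T) (g @ x @ word_inv g) (0, False) = Some (m, False)"
    using run_eqv[OF g(2)[unfolded eqv_def]] w(2) by simp
  then obtain h h' where h: "run (graph 0 S T) g (0, False) = Some h"
    "run (graph 0 S T) x h = Some h'" "run (graph 0 S T) (word_inv g) h' = Some (m, False)"
    by (auto simp: run_append split: bind_splits)
  from run_graph_inv[OF h(3)] have "run (graph 0 S T) g (0 + m, False) = Some h'" by simp
  from run_parallel[OF T(2) h(1) this] obtain p where p: "h = (p, False)" "h' = (p + m, False)"
    by blast
  \<comment> \<open>If \<open>x\<close> ran from \<open>p\<close> in the smaller comb, so would
    \<open>word_inv g @ w @ g\<close>. Its first factor leads from \<open>p\<close> back to 0, so
    \<open>w\<close> would run from there too.\<close>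
  have avoid: "run (graph lo hi T') x (p, False) = None"
    if sub: "0 \<le> lo" "hi \<le> S" "T' \<subseteq> T" and none: "run (graph lo hi T') w (0, False) = None" for lo hi T'
  proof (rule ccontr)
    assume "run (graph lo hi T') x (p, False) \<noteq> None"
    then have "run (graph lo hi T') (word_inv g @ w @ g) (p, False) \<noteq> None"
      using run_eqv[OF g(1)[unfolded eqv_def]] by simp
    then obtain v where v: "run (graph lo hi T') (word_inv g) (p, False) = Some v"
      "run (graph lo hi T') w v \<noteq> None"
      by (auto simp: run_append split: bind_splits)
    have "v = (0, False)"
      using run_graph_mono[OF v(1) sub] run_graph_inv[OF h(1)] p(1) by simp
    with v(2) none show False by simp
  qed
  have "2 * int (card T) + 2 * S - m \<le> int (length x)"
    using h(2) p m T(1) left right teeth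
    by (intro comb_tour_length[of S T x p m] avoid) auto
  with len show "length w \<le> length x" by simp
qed (fact w(1))

text \<open>The distances between the teeth are \<open>K\<close>, \<open>3 * K\<close>,
  \<open>4 * K\<close>, \<open>6 * K\<close> and \<open>7 * K\<close>, whereas the final height is
  \<open>2 * K\<close>.\<close>

lemma comb_word_ConjGeo:
  assumes "0 < K"
  shows "comb_word (3 * K) (3 * K) K (5 * K) \<in> ConjGeo X"
proof (rule comb_ConjGeo)
  let ?k = "int K"
  let ?T = "{0, 3 * ?k, 6 * ?k, 7 * ?k}"
  note run = comb_word_def run_append run_up run_down run_tooth
  show "run (graph 0 (7 * ?k) ?T) (comb_word (3 * K) (3 * K) K (5 * K)) (0, False) = Some (2 * ?k, False)"
    by (simp add: run del: run.simps)
  show "run (graph 1 (7 * ?k) ?T) (comb_word (3 * K) (3 * K) K (5 * K)) (0, False) = None"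
    using assms by (simp add: run del: run.simps)
  show "run (graph 0 (7 * ?k - 1) ?T) (comb_word (3 * K) (3 * K) K (5 * K)) (0, False) = None"
    using assms by (simp add: run del: run.simps)
  show "run (graph 0 (7 * ?k) (?T - {t})) (comb_word (3 * K) (3 * K) K (5 * K)) (0, False) = None"
    if "t \<in> ?T" for t
    using assms that by (auto simp add: run simp del: run.simps)
  show "t + 2 * ?k \<notin> ?T" if "t \<in> ?T" for t
    using assms that by auto
  have "card ?T = 4" using assms by simp
  then show "int (length (comb_word (3 * K) (3 * K) K (5 * K))) = 2 * int (card ?T) + 2 * (7 * ?k) - 2 * ?k"
    by (simp add: comb_word_def)
qed (use comb_word_words in auto)

end

section \<open>The automaton of comb words and the pumping argument\<close>

section \<open>Pumping comb words\<close>

context comb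
begin

text \<open>An automaton for the regular language of all comb words: the states 2, 4, 6 and 8 carry the
  loops, 8 is the accepting state and 9 the failure state.\<close>

definition delta :: "nat \<Rightarrow> 'a letter \<Rightarrow> nat" where
  "delta q l =
    (if q < 8 \<and> l = (if even q then Gen a else Inv a) then q + 1
     else if q \<in> {2, 4, 6} \<and> l = Gen b then q
     else if q = 8 \<and> l = Inv b then 8
     else 9)"

abbreviation state :: "nat \<Rightarrow> 'a letter list \<Rightarrow> nat" where
  "state \<equiv> foldl delta"

text \<open>Counts the letters read by a loop at state \<open>j\<close>. On a comb word the counts
  for 2, 4, 6 and 8 are the exponents \<open>c1\<close>, \<open>c2\<close>, \<open>c3\<close> and
  \<open>r\<close>.\<close>

primrec stay :: "nat \<Rightarrow> 'a letter list \<Rightarrow> nat \<Rightarrow> nat" where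
  "stay q [] j = 0"
| "stay q (l # w) j = of_bool (q = j \<and> delta q l = j) + stay (delta q l) w j"

lemma stay_append: "stay q (u @ v) j = stay q u j + stay (state q u) v j"
  by (induction u arbitrary: q) auto

lemma stay_le_length: "stay q w j \<le> length w"
proof (induction w arbitrary: q)
  case (Cons l w)
  from Cons[of "delta q l"] show ?case by auto
qed simp

lemma delta_mono: "q \<le> 9 \<Longrightarrow> q \<le> delta q l \<and> delta q l \<le> 9"
  by (auto simp: delta_def)

lemma state_mono: "q \<le> 9 \<Longrightarrow> q \<le> state q w \<and> state q w \<le> 9"
proof (induction w arbitrary: q)
  case (Cons l w)
  from Cons(1)[of "delta q l"] delta_mono[OF Cons(2), of l] show ?case by auto
qed simp

lemma stay_before: "q \<le> 9 \<Longrightarrow> state q w < j \<Longrightarrow> stay q w j = 0"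
proof (induction w arbitrary: q)
  case (Cons l w)
  from Cons.IH[of "delta q l"] Cons.prems delta_mono[OF Cons(2), of l]
    state_mono[of "delta q l" w] show ?case by auto
qed simp

lemma stay_after: "q \<le> 9 \<Longrightarrow> j < q \<Longrightarrow> stay q w j = 0"
proof (induction w arbitrary: q)
  case (Cons l w)
  from Cons.IH[of "delta q l"] Cons.prems delta_mono[OF Cons(2), of l] show ?case by auto
qed simp

text \<open>States never decrease along a run, so a run from \<open>q\<close> back to
  \<open>q\<close> uses only loops at \<open>q\<close>.\<close>

lemma stay_loop:
  "q \<le> 9 \<Longrightarrow> state q v = q \<Longrightarrow> stay q v j = (if q = j then length v else 0)"
proof (induction v)
  case (Cons l v)
  have "delta q l = q"
    using Cons.prems delta_mono[of q l] state_mono[of "delta q l" v] by simp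
  with Cons show ?case by simp
qed simp

lemma state_loop:
  assumes "q \<le> 8" "state q v = q" "v \<noteq> []"
  shows "q \<in> {2, 4, 6, 8}"
proof -
  from assms(3) obtain l v' where v: "v = l # v'" by (cases v) auto
  have "delta q l = q"
    using assms v delta_mono[of q l] state_mono[of "delta q l" v'] by simp
  show ?thesis
  proof (rule ccontr)
    assume "q \<notin> {2, 4, 6, 8}"
    then have "delta q l = q + 1 \<or> delta q l = 9" by (simp add: delta_def)
    with \<open>delta q l = q\<close> assms(1) show False by simp
  qed
qed

lemma state_power: "state q v = q \<Longrightarrow> state q (concat (replicate k v)) = q"
  by (induction k) auto

lemma state_9: "state 9 w = 9"
proof (induction w)
  case (Cons l w)
  have "delta 9 l = 9" by (simp add: delta_def)
  with Cons show ?case by simp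
qed simp

text \<open>An accepted run can leave \<open>q\<close> only through a complete tooth; every letter
  other than this and the loop leads to the failure state. State 0 has no loop, hence
  \<open>n = 0\<close> there.\<close>

lemma accept_tooth:
  assumes "state q w = 8" "q \<in> {0, 2, 4, 6}"
  obtains n w' where "w = up n @ tooth @ w'" "state (q + 2) w' = 8" "q = 0 \<Longrightarrow> n = 0"
proof -
  have "\<exists>n w'. w = up n @ tooth @ w' \<and> state (q + 2) w' = 8 \<and> (q = 0 \<longrightarrow> n = 0)"
    using assms(1)
  proof (induction w)
    case Nil
    with assms(2) show ?case by auto
  next
    case (Cons l w)
    consider "l = Gen a" | "q \<noteq> 0" "l = Gen b" | "delta q l = 9"
      by (cases "l = Gen a"; cases "l = Gen b") (use assms(2) in \<open>auto simp: delta_def\<close>)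
    then show ?case
    proof cases
      case 1
      with assms(2) have "delta q l = q + 1" by (auto simp: delta_def)
      with Cons.prems have w: "state (q + 1) w = 8" by simp
      then obtain l' w' where w': "w = l' # w'" using assms(2) by (cases w) auto
      have "l' = Inv a"
      proof (rule ccontr)
        assume "l' \<noteq> Inv a"
        then have "delta (q + 1) l' = 9" using assms(2) by (auto simp: delta_def)
        with w w' state_9 show False by simp
      qed
      moreover have "delta (q + 1) (Inv a) = q + 2" using assms(2) by (auto simp: delta_def)
      ultimately show ?thesis
        using w w' 1 by (intro exI[of _ 0] exI[of _ w']) simp
    next
      case 2
      then have "delta q l = q" using assms(2) ab by (auto simp: delta_def)
      with Cons obtain n w' where "w = up n @ tooth @ w'" "state (q + 2) w' = 8" by auto
      with 2 show ?thesis by (intro exI[of _ "Suc n"] exI[of _ w']) auto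
    next
      case 3
      with Cons.prems state_9 show ?thesis by simp
    qed
  qed
  then show ?thesis using that by blast
qed

lemma accept_down: "state 8 w = 8 \<Longrightarrow> \<exists>n. w = down n"
proof (induction w)
  case (Cons l w)
  then have "delta 8 l \<noteq> 9" using state_9 by auto
  then have l: "l = Inv b" "delta 8 l = 8" by (auto simp: delta_def split: if_splits)
  with Cons obtain n where "w = down n" by auto
  with l show ?case by (intro exI[of _ "Suc n"]) simp
qed simp

lemma accept_comb_word:
  assumes "state 0 w = 8"
  obtains c1 c2 c3 r where "w = comb_word c1 c2 c3 r"
proof -
  from assms obtain n0 w0 where 0: "w = up n0 @ tooth @ w0" "state 2 w0 = 8" "n0 = 0"
    by (rule accept_tooth) (auto simp: numeral_2_eq_2)
  from 0(2) obtain n1 w1 where 1: "w0 = up n1 @ tooth @ w1" "state 4 w1 = 8"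
    by (rule accept_tooth) auto
  from 1(2) obtain n2 w2 where 2: "w1 = up n2 @ tooth @ w2" "state 6 w2 = 8"
    by (rule accept_tooth) auto
  from 2(2) obtain n3 w3 where 3: "w2 = up n3 @ tooth @ w3" "state 8 w3 = 8"
    by (rule accept_tooth) auto
  from accept_down[OF 3(2)] obtain r where "w3 = down r" by blast
  with 0 1 2 3 show ?thesis by (intro that[of n1 n2 n3 r]) (simp add: comb_word_def)
qed

lemma state_up: "q \<in> {2, 4, 6} \<Longrightarrow> state q (up n) = q"
  using ab by (induction n) (auto simp: delta_def)

lemma state_down: "state 8 (down n) = 8"
  by (induction n) (auto simp: delta_def)

lemma delta_teeth:
  "delta 0 (Gen a) = 1" "delta 1 (Inv a) = 2" "delta 2 (Gen a) = 3" "delta 3 (Inv a) = 4"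
  "delta 4 (Gen a) = 5" "delta 5 (Inv a) = 6" "delta 6 (Gen a) = 7" "delta 7 (Inv a) = 8"
  by (simp_all add: delta_def)

lemma state_comb_word: "state 0 (comb_word c1 c2 c3 r) = 8"
  by (simp add: comb_word_def state_up state_down delta_teeth del: One_nat_def)

lemma stay_comb_word:
  "stay 0 (comb_word c1 c2 c3 r) 2 = c1" "stay 0 (comb_word c1 c2 c3 r) 4 = c2"
  "stay 0 (comb_word c1 c2 c3 r) 6 = c3" "stay 0 (comb_word c1 c2 c3 r) 8 = r"
proof -
  have "stay q (up n) j = (if q = j then n else 0)" if "q \<in> {2, 4, 6}" for q n j
    using stay_loop[OF _ state_up[OF that], of n j] that by auto
  moreover have "stay 8 (down n) j = (if 8 = j then n else 0)" for n j
    using stay_loop[OF _ state_down, of n j] by simp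
  ultimately show
    "stay 0 (comb_word c1 c2 c3 r) 2 = c1" "stay 0 (comb_word c1 c2 c3 r) 4 = c2"
    "stay 0 (comb_word c1 c2 c3 r) 6 = c3" "stay 0 (comb_word c1 c2 c3 r) 8 = r"
    by (simp_all add: comb_word_def state_up state_down stay_append delta_teeth del: One_nat_def)
qed

text \<open>The four counts determine an accepted word, so a pumped word is known once its counts
  are.\<close>

lemma accept_eq_comb_word:
  assumes "state 0 w = 8"
  shows "w = comb_word (stay 0 w 2) (stay 0 w 4) (stay 0 w 6) (stay 0 w 8)"
proof -
  from assms obtain c1 c2 c3 r where "w = comb_word c1 c2 c3 r"
    by (rule accept_comb_word)
  then show ?thesis by (simp add: stay_comb_word)
qed

theorem ConjGeo_not_cfg_lang:
  fixes G :: "('n, 'a letter) cfg"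
  assumes "wf_cfg G"
  shows "cfg_lang G \<noteq> ConjGeo X"
proof
  assume L: "cfg_lang G = ConjGeo X"
  \<comment> \<open>There are ten colours, one for each of the states 0 to 9.\<close>
  obtain N where pump: "\<And>w (col :: nat \<Rightarrow> nat).
    \<lbrakk>w \<in> cfg_lang G; N \<le> length w; \<And>i. col i < 10\<rbrakk> \<Longrightarrow>
    \<exists>u v x y z. w = u @ v @ x @ y @ z \<and> length (v @ x @ y) \<le> N \<and> v @ y \<noteq> []
      \<and> col (length u) = col (length (u @ v))
      \<and> col (length (u @ v @ x)) = col (length (u @ v @ x @ y))
      \<and> (\<forall>k. u @ concat (replicate k v) @ x @ concat (replicate k y) @ z \<in> cfg_lang G)"
    using coloured_pumping[OF assms, of 10] by blast
  \<comment> \<open>Every number from 1 to \<open>N\<close> divides \<open>K\<close>, so any growth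
    per copy can be repeated until it totals exactly \<open>K\<close>.\<close>
  define K where "K = (fact N :: nat)"
  have K: "0 < K" "N \<le> K" by (simp_all add: K_def fact_ge_self)
  have dvd: "\<exists>k. k * d = K" if "0 < d" "d \<le> N" for d
    using dvd_fact[of d N] that by (auto simp: K_def mult.commute)
  define w where "w = comb_word (3 * K) (3 * K) K (5 * K)"
  have "w \<in> cfg_lang G" using comb_word_ConjGeo[OF K(1)] by (simp add: L w_def)
  moreover have "N \<le> length w" using K by (simp add: w_def comb_word_def)
  moreover have "state 0 (take i w) < 10" for i using state_mono[of 0 "take i w"] by simp
  ultimately obtain u v x y z where w: "w = u @ v @ x @ y @ z"
    and len: "length (v @ x @ y) \<le> N" "v @ y \<noteq> []"
    and col: "state 0 (take (length u) w) = state 0 (take (length (u @ v)) w)"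
      "state 0 (take (length (u @ v @ x)) w) = state 0 (take (length (u @ v @ x @ y)) w)"
    and mem: "\<And>k. u @ concat (replicate k v) @ x @ concat (replicate k y) @ z \<in> cfg_lang G"
    using pump[of w "\<lambda>i. state 0 (take i w)"] by blast
  define p q where "p = state 0 u" and "q = state p x"
  have p: "state p v = p" using col(1) by (simp add: w p_def)
  have q: "state q y = q" using col(2) p by (simp add: w p_def q_def)
  have final: "state q z = 8"
    using state_comb_word[of "3 * K" "3 * K" K "5 * K"] p q
    by (simp add: w_def[symmetric] w p_def[symmetric] q_def[symmetric])
  have "p \<le> 9" using state_mono[of 0 u] by (simp add: p_def)
  then have "p \<le> q" "q \<le> 9" using state_mono[of p x] by (simp_all add: q_def)
  then have "q \<le> 8" using state_mono[of q z] final by simp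
  with \<open>p \<le> q\<close> have "p \<le> 8" by simp
  \<comment> \<open>The growth of block \<open>j\<close> for each additional copy of
    \<open>v\<close> and \<open>y\<close>.\<close>
  define d where "d j = (if p = j then length v else 0) + (if q = j then length y else 0)" for j
  have stay: "stay 0 (u @ concat (replicate (Suc k) v) @ x @ concat (replicate (Suc k) y) @ z) j
      = stay 0 w j + k * d j" for k j
  proof -
    have pow: "stay r (concat (replicate m t)) j = m * (if r = j then length t else 0)"
      if "r \<le> 8" "state r t = r" for r t m
      using stay_loop[OF _ state_power[OF that(2), of m], of j] that(1)
      by (simp add: length_concat sum_list_replicate)
    show ?thesis
      using pow[OF \<open>p \<le> 8\<close> p] pow[OF \<open>q \<le> 8\<close> q] pow[OF \<open>p \<le> 8\<close> p, of 1] pow[OF \<open>q \<le> 8\<close> q, of 1]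
      by (simp add: w stay_append p q state_power p_def[symmetric] q_def[symmetric] d_def
          algebra_simps)
  qed
  have ConjGeo: "comb_word (3 * K + k * d 2) (3 * K + k * d 4) (K + k * d 6) (5 * K + k * d 8)
      \<in> ConjGeo X" for k
  proof -
    let ?w = "u @ concat (replicate (Suc k) v) @ x @ concat (replicate (Suc k) y) @ z"
    have "state 0 ?w = 8"
      using state_power[OF p, of "Suc k"] state_power[OF q, of "Suc k"] final
      by (simp add: p_def[symmetric] q_def[symmetric] p q del: replicate_Suc)
    from accept_eq_comb_word[OF this]
    show ?thesis
      using mem[of "Suc k"] by (simp add: L stay stay_comb_word w_def del: replicate_Suc)
  qed
  have sum: "d 2 + d 4 + d 6 + d 8 = length v + length y"
  proof -
    have "v = [] \<or> p \<in> {2, 4, 6, 8}" "y = [] \<or> q \<in> {2, 4, 6, 8}"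
      using state_loop[OF \<open>p \<le> 8\<close> p] state_loop[OF \<open>q \<le> 8\<close> q] by auto
    then show ?thesis by (auto simp: d_def)
  qed
  have pos: "0 < d 2 + d 4 + d 6 + d 8" "d 2 + d 4 + d 6 + d 8 \<le> N"
    unfolding sum using len by auto
  \<comment> \<open>If the first or second block grew together with the last one, \<open>v\<close>
    would lie in the former and \<open>y\<close> in the latter. Then \<open>x\<close> would contain
    the whole third block, of length \<open>K\<close>, although it is shorter than
    \<open>N\<close>.\<close>
  have window: "d 2 = 0 \<and> d 4 = 0" if "0 < d 8"
  proof (rule ccontr)
    assume "\<not> ?thesis"
    with that \<open>p \<le> q\<close> have pq: "p \<le> 4" "q = 8" "v \<noteq> []"
      by (auto simp: d_def split: if_splits)
    have "K = stay 0 w 6" by (simp add: w_def stay_comb_word)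
    also have "\<dots> = stay p x 6"
      using pq stay_before[of 0 u 6] stay_before[of p v 6] p q stay_after[of 8 6]
      by (simp add: w stay_append p_def[symmetric] q_def[symmetric])
    also have "\<dots> \<le> length x" by (rule stay_le_length)
    also have "\<dots> < N" using len(1) pq(3) by (cases v) auto
    finally show False using K(2) by simp
  qed
  \<comment> \<open>The three cases lead to \<open>r = c1 + c2 = 6 * K\<close>, to
    \<open>r = c1 + c3 = 5 * K\<close> and to \<open>r = c2 + c3 = 5 * K\<close>.\<close>
  consider "0 < d 8" | "d 8 = 0" "0 < d 2 + d 6" | "d 2 = 0" "d 6 = 0" "d 8 = 0" "0 < d 4"
    using pos(1) by linarith
  then show False
  proof cases
    case 1
    then obtain k where "k * d 8 = K" using dvd[of "d 8"] pos by auto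
    then show False
      using ConjGeo[of k] window[OF 1] comb_word_not_ConjGeo[of "5 * K + K" "3 * K" "3 * K" "K + k * d 6"]
      by simp
  next
    case 2
    then obtain k where "k * (d 2 + d 6) = K" using dvd[of "d 2 + d 6"] pos by auto
    then show False
      using ConjGeo[of k] 2 comb_word_not_ConjGeo[of "5 * K" "3 * K + k * d 2" "3 * K + k * d 4" "K + k * d 6"]
      by (simp add: algebra_simps)
  next
    case 3
    then obtain k where "k * d 4 = K" using dvd[of "d 4"] pos by auto
    then show False
      using ConjGeo[of k] 3 comb_word_not_ConjGeo[of "5 * K" "3 * K" "3 * K + K" K]
      by simp
  qed
qed

end

theorem theorem3p5:
  fixes X :: "'a set"
  assumes "finite X" and "card X \<ge> 2"
  shows "\<not> context_free (letters X) (ConjGeo X)"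
proof -
  from assms(2) obtain a b where "a \<in> X" "b \<in> X" "a \<noteq> b"
    by (metis card_2_iff' obtain_subset_with_card_n subset_eq)
  then interpret comb X a b by unfold_locales
  show ?thesis unfolding context_free_def using ConjGeo_not_cfg_lang by blast
qed

end
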